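(* Let $x(t)=(x_1(t),\dots,x_n(t))$, $t\ge0$, be a solution of the RoPE spherical self-attention flow on $(\mathbb{S}^{d-1})^n$ (arbitrary fixed positions, frequencies, and finite $\beta\ge0$), and put $\underline a=\dfrac{1}{1+(n-1)e^{2\beta}}$. Assume that either (a) $\min_{i<j}\langle x_i(0),x_j(0)\rangle\ge0$; or (b) $d=2$ and there are real phase lifts $\theta_i(0)$ of $x_i(0)$, i.e. $x_i(0)=(\cos\theta_i(0),\sin\theta_i(0))$, with $\max_i\theta_i(0)-\min_i\theta_i(0)<\pi$. Then all tokens converge to a common point $x_\infty\in\mathbb{S}^{d-1}$. Let $D(t)=\max_{i,j}d_{\mathbb{S}}(x_i(t),x_j(t))$ be the maximal geodesic diameter and set $$q_0=\tan\frac{D(0)}2,\qquad Q(t)=q_0e^{-2\underline a t}.$$ Then for every $i$ and $t\ge0$, $$d_{\mathbb{S}}(x_i(t),x_\infty)\le\frac{1}{\underline a}\operatorname{arsinh}Q(t)\le\frac{q_0}{\underline a}e^{-2\underline a t}.$$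
   Context: Let $n\ge2$ and $d=2r$ with $r\ge1$. Token $i$ has a fixed position $p_i\in\mathbb{R}$ and state $x_i\in\mathbb{S}^{d-1}$. For real frequencies $\omega_1,\dots,\omega_r$, define the block rotation $R_p=\bigoplus_{\ell=1}^r\begin{pmatrix}\cos(\omega_\ell p)&-\sin(\omega_\ell p)\\ \sin(\omega_\ell p)&\cos(\omega_\ell p)\end{pmatrix}$. For finite $\beta\ge0$: $s_{ij}(x)=\langle R_{p_i}x_i,R_{p_j}x_j\rangle$, $W_{ij}(x)=e^{\beta s_{ij}(x)}$, $Z_i(x)=\sum_kW_{ik}(x)$, $A_{ij}(x)=W_{ij}(x)/Z_i(x)$. The flow is $\dot x_i=\sum_{j=1}^nA_{ij}(x)(x_j-\langle x_i,x_j\rangle x_i)$; it has a unique global solution for every initial state in $(\mathbb{S}^{d-1})^n$. $d_{\mathbb{S}}(x,y)=\arccos\langle x,y\rangle$ is the geodesic distance on the sphere. *)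

theory Defs
  imports "HOL-Analysis.Analysis"
begin

text \<open>The ambient space is \<open>real ^ ('r \<times> 2)\<close>, i.e. Euclidean space of dimension
  \<open>d = 2r\<close> with \<open>r = CARD('r) \<ge> 1\<close>; the pairs \<open>(l, 1)\<close> and \<open>(l, 2)\<close> index the two coordinates
  of the \<open>l\<close>-th block.  Tokens are indexed by \<open>{1..n}\<close>; a configuration is a function on \<open>nat\<close>
  whose values outside \<open>{1..n}\<close> are irrelevant.\<close>

definition rotation2 :: "real \<Rightarrow> real ^ 2 ^ 2" where
  "rotation2 a = vector [vector [cos a, - sin a], vector [sin a, cos a]]"

definition rope :: "('r::finite \<Rightarrow> real) \<Rightarrow> real \<Rightarrow> real ^ ('r \<times> 2) ^ ('r \<times> 2)" where
  "rope \<omega> p = (\<chi> u v. if fst u = fst v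
                   then rotation2 (\<omega> (fst u) * p) $ snd u $ snd v else 0)"

definition score ::
  "('r::finite \<Rightarrow> real) \<Rightarrow> (nat \<Rightarrow> real) \<Rightarrow> (nat \<Rightarrow> real ^ ('r \<times> 2)) \<Rightarrow> nat \<Rightarrow> nat \<Rightarrow> real" where
  "score \<omega> p x i j = (rope \<omega> (p i) *v x i) \<bullet> (rope \<omega> (p j) *v x j)"

definition kernel ::
  "('r::finite \<Rightarrow> real) \<Rightarrow> real \<Rightarrow> (nat \<Rightarrow> real) \<Rightarrow> (nat \<Rightarrow> real ^ ('r \<times> 2)) \<Rightarrow> nat \<Rightarrow> nat \<Rightarrow> real" where
  "kernel \<omega> \<beta> p x i j = exp (\<beta> * score \<omega> p x i j)"

definition attention ::
  "nat \<Rightarrow> ('r::finite \<Rightarrow> real) \<Rightarrow> real \<Rightarrow> (nat \<Rightarrow> real) \<Rightarrow>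
   (nat \<Rightarrow> real ^ ('r \<times> 2)) \<Rightarrow> nat \<Rightarrow> nat \<Rightarrow> real" where
  "attention n \<omega> \<beta> p x i j = kernel \<omega> \<beta> p x i j / (\<Sum>k=1..n. kernel \<omega> \<beta> p x i k)"

definition rope_field ::
  "nat \<Rightarrow> ('r::finite \<Rightarrow> real) \<Rightarrow> real \<Rightarrow> (nat \<Rightarrow> real) \<Rightarrow>
   (nat \<Rightarrow> real ^ ('r \<times> 2)) \<Rightarrow> nat \<Rightarrow> real ^ ('r \<times> 2)" where
  "rope_field n \<omega> \<beta> p x i =
     (\<Sum>j=1..n. attention n \<omega> \<beta> p x i j *\<^sub>R (x j - (x i \<bullet> x j) *\<^sub>R x i))"

text \<open>Solutions on \<open>t \<ge> 0\<close>; the derivative is one-sided at \<open>t = 0\<close>.\<close>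

definition rope_flow_solution ::
  "nat \<Rightarrow> ('r::finite \<Rightarrow> real) \<Rightarrow> real \<Rightarrow> (nat \<Rightarrow> real) \<Rightarrow>
   (real \<Rightarrow> nat \<Rightarrow> real ^ ('r \<times> 2)) \<Rightarrow> bool" where
  "rope_flow_solution n \<omega> \<beta> p x \<longleftrightarrow>
     (\<forall>t\<ge>0. \<forall>i\<in>{1..n}. x t i \<in> sphere 0 1 \<and>
        ((\<lambda>s. x s i) has_vector_derivative rope_field n \<omega> \<beta> p (x t) i) (at t within {0..}))"

definition sphere_dist :: "'a::real_inner \<Rightarrow> 'a \<Rightarrow> real" where
  "sphere_dist u v = arccos (u \<bullet> v)"

definition geodesic_diameter :: "nat \<Rightarrow> (nat \<Rightarrow> 'a::real_inner) \<Rightarrow> real" where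
  "geodesic_diameter n x = Max ((\<lambda>(i, j). sphere_dist (x i) (x j)) ` ({1..n} \<times> {1..n}))"

end

theory Submission
  imports Defs "HOL-Real_Asymp.Real_Asymp"
begin

text \<open>
  The positions enter the flow only through the attention weights. Block rotations are isometries,
  so every score of unit tokens lies in \<open>[-1, 1]\<close>; hence each weight is at least \<open>a\<close>, and each row of
  weights sums to \<open>1\<close>. The contraction and the rate follow from these two properties in the locale
  \<open>sphere_consensus\<close>; on the circle, continuity of the weights in time also gives the phase lifts.

  For the contraction, follow the worst pair of tokens. If \<open>m\<close> is the least inner product and \<open>m \<ge> 0\<close>,
  every token pulls the two members of the worst pair together or leaves their inner product
  alone, and the two mutual pulls alone give \<open>m' \<ge> 2 a (1 - m\<^sup>2)\<close>. On the circle
  the extreme phases of a lift move inwards, and the width \<open>D\<close> of the arc satisfies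
  \<open>D' \<le> - 2 a sin D\<close>. With \<open>m = cos D\<close> these are the same inequality, and it is linear in
  \<open>q = tan (D / 2)\<close>, namely \<open>q' \<le> - 2 a q\<close>. So in both cases the inner products stay above
  \<open>(1 - Q\<^sup>2) / (1 + Q\<^sup>2)\<close> with \<open>Q t = q0 exp (- 2 a t)\<close> (\<open>acute_contraction\<close>, \<open>arc_contraction\<close>).
  The minimum over pairs is not differentiable, so the comparison is made at the first time at which
  some pair meets a barrier that moves strictly more slowly (\<open>first_contact\<close>); the extra slack then tends
  to \<open>0\<close>.

  For the rate, the velocity of a token is an average of tangential parts of chords to the other tokens,
  hence at most the largest chord \<open>2 sin (D / 2) \<le> 2 Q / sqrt (1 + Q\<^sup>2)\<close> (\<open>speed_bound\<close>).
  This bound is exactly the derivative of \<open>- arsinh Q / a\<close>, so \<open>arsinh (Q t) / a\<close> bounds the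
  length of the path still to be travelled after time \<open>t\<close>: the tokens converge, their limits agree
  because the chords vanish, and the geodesic distance to the limit is at most the remaining length
  (\<open>consensus_rate\<close>).
\<close>

section \<open>First contact with a moving barrier\<close>

text \<open>At the first time \<open>\<tau>\<close> at which some \<open>f j\<close> meets the barrier, \<open>f j - b\<close> has just come down to \<open>0\<close>
  from positive values, while the contact condition makes its derivative positive there. The contact
  condition may assume that no other function is below the barrier, which replaces
  differentiating a minimum of finitely many functions.\<close>

lemma first_contact:
  fixes f f' :: "'i \<Rightarrow> real \<Rightarrow> real" and b b' :: "real \<Rightarrow> real"
  assumes fin: "finite I"
    and df: "\<And>i t. i \<in> I \<Longrightarrow> t \<ge> 0 \<Longrightarrow> (f i has_real_derivative f' i t) (at t within {0..})"
    and db: "\<And>t. t \<ge> 0 \<Longrightarrow> (b has_real_derivative b' t) (at t within {0..})"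
    and start: "\<And>i. i \<in> I \<Longrightarrow> b 0 < f i 0"
    and contact: "\<And>i t. i \<in> I \<Longrightarrow> t > 0 \<Longrightarrow> f i t = b t \<Longrightarrow> (\<forall>j\<in>I. b t \<le> f j t) \<Longrightarrow> b' t < f' i t"
    and i: "i \<in> I" and t: "t \<ge> 0"
  shows "b t < f i t"
proof (rule ccontr)
  assume "\<not> b t < f i t"
  define S where "S = (\<Union>j\<in>I. {s\<in>{0..}. f j s - b s \<le> 0})"
  have cont: "continuous_on {0..} (\<lambda>s. f j s - b s)" if "j \<in> I" for j
    using df[OF that] db
    by (intro continuous_on_diff) (auto intro!: DERIV_continuous_on)
  have "closed S"
    unfolding S_def
  proof (intro closed_UN fin ballI)
    fix j assume "j \<in> I"
    have "{s\<in>{0..}. f j s - b s \<le> 0} = {0..} \<inter> (\<lambda>s. f j s - b s) -` {..0}" by auto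
    also have "closed \<dots>"
      by (intro continuous_closed_preimage cont \<open>j \<in> I\<close>) auto
    finally show "closed {s\<in>{0..}. f j s - b s \<le> 0}" .
  qed
  moreover have "t \<in> S"
    using \<open>\<not> b t < f i t\<close> i t by (auto simp: S_def not_less)
  moreover have "bdd_below S"
    by (auto simp: S_def intro!: bdd_belowI[of _ 0])
  ultimately have inS: "Inf S \<in> S" by (intro closed_contains_Inf) auto
  define \<tau> where "\<tau> = Inf S"
  have before: "b s < f j s" if "0 \<le> s" "s < \<tau>" "j \<in> I" for s j
  proof (rule ccontr)
    assume "\<not> b s < f j s"
    then have "s \<in> S" using that by (auto simp: S_def not_less)
    then have "\<tau> \<le> s" unfolding \<tau>_def by (intro cInf_lower \<open>bdd_below S\<close>)
    with that show False by simp
  qed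
  from inS obtain j where j: "j \<in> I" "0 \<le> \<tau>" "f j \<tau> \<le> b \<tau>"
    by (auto simp: S_def \<tau>_def)
  have \<tau>: "\<tau> > 0" using j start[of j] by (cases "\<tau> = 0") auto
  then have within: "at \<tau> within {0..} = at \<tau>"
    by (intro at_within_interior) (auto simp: interior_real_atLeast)
  have reach: "b \<tau> \<le> f k \<tau>" if k: "k \<in> I" for k
  proof -
    have "((\<lambda>s. f k s - b s) \<longlongrightarrow> f k \<tau> - b \<tau>) (at_left \<tau>)"
    proof (rule tendsto_within_subset)
      show "((\<lambda>s. f k s - b s) \<longlongrightarrow> f k \<tau> - b \<tau>) (at \<tau>)"
        using cont[OF k] \<tau> within by (auto simp: continuous_on dest!: bspec[of _ _ \<tau>])
    qed auto
    moreover have "eventually (\<lambda>s. 0 \<le> f k s - b s) (at_left \<tau>)"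
      using eventually_at_left_real[OF \<tau>] by eventually_elim
        (use before[OF _ _ k] in \<open>auto simp: less_imp_le\<close>)
    ultimately have "0 \<le> f k \<tau> - b \<tau>"
      by (intro tendsto_lowerbound[of _ _ "at_left \<tau>"]) auto
    then show ?thesis by simp
  qed
  have eq: "f j \<tau> = b \<tau>" using j reach[of j] by simp
  have "((\<lambda>s. f j s - b s) has_real_derivative (f' j \<tau> - b' \<tau>)) (at \<tau>)"
    using DERIV_diff[OF df[of j \<tau>] db[of \<tau>]] j within by simp
  moreover have "f' j \<tau> - b' \<tau> > 0"
    using contact[of j \<tau>] j \<tau> eq reach by auto
  ultimately obtain d where d: "d > 0" "\<And>h. h > 0 \<Longrightarrow> h < d \<Longrightarrow> f j (\<tau> - h) - b (\<tau> - h) < f j \<tau> - b \<tau>"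
    using DERIV_pos_inc_left by blast
  define h where "h = min (d / 2) (\<tau> / 2)"
  have "f j (\<tau> - h) - b (\<tau> - h) < 0" "b (\<tau> - h) < f j (\<tau> - h)"
    using d(2)[of h] before[of "\<tau> - h" j] d(1) \<tau> eq j by (auto simp: h_def)
  then show False by simp
qed

lemma le_at_zero_perturbation:
  fixes g :: "real \<Rightarrow> real"
  assumes "isCont g 0" and "\<And>\<epsilon>. \<epsilon> > 0 \<Longrightarrow> g \<epsilon> \<le> c"
  shows "g 0 \<le> c"
proof (rule tendsto_upperbound[where F = "at_right 0"])
  show "(g \<longlongrightarrow> g 0) (at_right 0)"
    using assms(1) by (auto simp: isCont_def intro: tendsto_within_subset)
  show "\<forall>\<^sub>F \<epsilon> in at_right 0. g \<epsilon> \<le> c"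
    using assms(2) by (auto simp: eventually_at_filter)
qed auto

section \<open>The tangent half-angle substitution\<close>

text \<open>This is \<open>cos D\<close> as a function of \<open>q = tan (D / 2)\<close>. The three derivative formulas below
  express that along \<open>q' = - 2 k q\<close> the angle obeys \<open>D' = - 2 k sin D\<close>, its cosine
  \<open>m' = 2 k (1 - m\<^sup>2)\<close>, and \<open>arsinh q / k\<close> decreases at the rate \<open>2 sin (D / 2)\<close>.\<close>

definition cos_half_tan :: "real \<Rightarrow> real" where
  "cos_half_tan q = (1 - q\<^sup>2) / (1 + q\<^sup>2)"

lemma one_plus_square_pos: "0 < 1 + q\<^sup>2" "1 + q\<^sup>2 \<noteq> 0" for q :: real
  by (auto simp: add_pos_nonneg add_nonneg_eq_0_iff)

lemma cos_half_tan_tan: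
  assumes "cos (D / 2) \<noteq> 0"
  shows "cos_half_tan (tan (D / 2)) = cos D"
proof -
  have "cos D = (cos (D/2))\<^sup>2 - (sin (D/2))\<^sup>2" using cos_double[of "D/2"] by simp
  moreover have "1 + (tan (D/2))\<^sup>2 = 1 / (cos (D/2))\<^sup>2"
    using assms by (simp add: tan_sec power_inverse inverse_eq_divide power_one_over)
  moreover have "1 - (tan (D/2))\<^sup>2 = ((cos (D/2))\<^sup>2 - (sin (D/2))\<^sup>2) / (cos (D/2))\<^sup>2"
    using assms by (simp add: tan_def power_divide field_simps)
  ultimately show ?thesis using assms by (simp add: cos_half_tan_def)
qed

lemma cos_double_arctan: "cos (2 * arctan q) = cos_half_tan q"
  using cos_half_tan_tan[of "2 * arctan q"] by (simp add: tan_arctan)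

lemma sin_double_arctan: "sin (2 * arctan q) = 2 * q / (1 + q\<^sup>2)"
proof -
  have "sqrt (1 + q\<^sup>2) * sqrt (1 + q\<^sup>2) = 1 + q\<^sup>2"
    using one_plus_square_pos[of q] by simp
  then show ?thesis by (simp add: sin_double sin_arctan cos_arctan)
qed

lemma one_minus_cos_half_tan: "1 - cos_half_tan q = 2 * q\<^sup>2 / (1 + q\<^sup>2)"
  using one_plus_square_pos[of q] by (simp add: cos_half_tan_def field_simps)

lemma one_minus_cos_half_tan_square: "1 - (cos_half_tan q)\<^sup>2 = 4 * q\<^sup>2 / (1 + q\<^sup>2)\<^sup>2"
proof -
  have "(1 + q\<^sup>2)\<^sup>2 - (1 - q\<^sup>2)\<^sup>2 = 4 * q\<^sup>2"
    by (simp add: power2_eq_square algebra_simps)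
  moreover have "1 - (cos_half_tan q)\<^sup>2 = ((1 + q\<^sup>2)\<^sup>2 - (1 - q\<^sup>2)\<^sup>2) / (1 + q\<^sup>2)\<^sup>2"
    unfolding cos_half_tan_def power_divide
    using one_plus_square_pos(2)[of q] by (subst diff_divide_distrib) simp
  ultimately show ?thesis by simp
qed

lemma cos_half_tan_antimono:
  assumes "0 \<le> q" "q < r" shows "cos_half_tan r < cos_half_tan q"
proof -
  have "q\<^sup>2 < r\<^sup>2" using assms by (intro power_strict_mono) auto
  then show ?thesis
    using one_plus_square_pos[of q] one_plus_square_pos[of r]
    by (simp add: cos_half_tan_def field_simps)
qed

lemma cos_half_tan_less_1: "q > 0 \<Longrightarrow> cos_half_tan q < 1"
  using cos_half_tan_antimono[of 0 q] by (simp add: cos_half_tan_def)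

lemma DERIV_cos_half_tan_exp:
  fixes c k :: real
  defines "q \<equiv> \<lambda>t. c * exp (- 2 * k * t)"
  shows "((\<lambda>t. cos_half_tan (q t)) has_real_derivative 2 * k * (1 - (cos_half_tan (q t))\<^sup>2)) (at t within S)"
proof -
  have q: "(q has_real_derivative - 2 * k * q t) (at t within S)"
    unfolding q_def by (auto intro!: derivative_eq_intros)
  have "((\<lambda>t. cos_half_tan (q t)) has_real_derivative
      ((- (2 * q t * (- 2 * k * q t))) * (1 + (q t)\<^sup>2) - (1 - (q t)\<^sup>2) * (2 * q t * (- 2 * k * q t)))
        / (1 + (q t)\<^sup>2)\<^sup>2) (at t within S)"
    unfolding cos_half_tan_def
    using one_plus_square_pos[of "q t"]
    by (auto intro!: derivative_eq_intros q simp: power2_eq_square)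
  moreover have "(- (2 * q t * (- 2 * k * q t))) * (1 + (q t)\<^sup>2) - (1 - (q t)\<^sup>2) * (2 * q t * (- 2 * k * q t))
      = 2 * k * (4 * (q t)\<^sup>2)"
    by (simp add: power2_eq_square algebra_simps)
  ultimately show ?thesis
    by (simp add: one_minus_cos_half_tan_square)
qed

lemma DERIV_double_arctan_exp:
  fixes c k :: real
  defines "q \<equiv> \<lambda>t. c * exp (- 2 * k * t)"
  shows "((\<lambda>t. 2 * arctan (q t)) has_real_derivative - 2 * k * sin (2 * arctan (q t))) (at t within S)"
proof -
  have q: "(q has_real_derivative - 2 * k * q t) (at t within S)"
    unfolding q_def by (auto intro!: derivative_eq_intros)
  show ?thesis
    by (rule derivative_eq_intros q refl)+
      (simp add: sin_double_arctan inverse_eq_divide)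
qed

lemma DERIV_arsinh_exp:
  fixes c k :: real
  defines "q \<equiv> \<lambda>t. c * exp (- 2 * k * t)"
  assumes "k \<noteq> 0"
  shows "((\<lambda>t. arsinh (q t) / k) has_real_derivative - (2 * q t / sqrt ((q t)\<^sup>2 + 1))) (at t within S)"
proof -
  have q: "(q has_real_derivative - 2 * k * q t) (at t within S)"
    unfolding q_def by (auto intro!: derivative_eq_intros)
  have "((\<lambda>t. arsinh (q t)) has_real_derivative (1 / sqrt ((q t)\<^sup>2 + 1)) * (- 2 * k * q t)) (at t within S)"
    by (rule DERIV_chain2[OF arsinh_real_has_field_derivative q])
  from DERIV_cdivide[OF this, of k] show ?thesis using assms(2) by simp
qed

lemma arsinh_le_self:
  assumes "0 \<le> q" shows "arsinh q \<le> (q :: real)"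
proof -
  have "(\<lambda>t. t - arsinh t) 0 \<le> (\<lambda>t. t - arsinh t) q"
  proof (rule DERIV_nonneg_imp_nondecreasing[OF assms])
    fix t :: real assume "0 \<le> t" "t \<le> q"
    have "((\<lambda>t. t - arsinh t) has_real_derivative 1 - 1 / sqrt (t\<^sup>2 + 1)) (at t)"
      by (rule DERIV_diff[OF DERIV_ident arsinh_real_has_field_derivative])
    moreover have "1 - 1 / sqrt (t\<^sup>2 + 1) \<ge> 0"
      by (simp add: divide_le_eq_1 add_nonneg_pos)
    ultimately show "\<exists>y. ((\<lambda>t. t - arsinh t) has_real_derivative y) (at t) \<and> 0 \<le> y" by blast
  qed
  then show ?thesis by simp
qed

section \<open>Curves of finite remaining length\<close>

text \<open>The bound \<open>G t\<close> is uniform over all later times, so the values at integer times form a Cauchy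
  sequence, and the same bound carries its limit over to real times.\<close>

lemma convergent_if_increments_vanish:
  fixes f :: "real \<Rightarrow> 'a::banach" and G :: "real \<Rightarrow> real"
  assumes increment: "\<And>t s. 0 \<le> t \<Longrightarrow> t \<le> s \<Longrightarrow> norm (f s - f t) \<le> G t"
    and G_lim: "(G \<longlongrightarrow> 0) at_top"
  shows "\<exists>y. (f \<longlongrightarrow> y) at_top"
proof -
  have "Cauchy (\<lambda>k. f (real k))"
  proof (rule metric_CauchyI)
    fix e :: real assume "e > 0"
    have "eventually (\<lambda>k. G (real k) < e / 2) sequentially"
      using order_tendstoD(2)[OF filterlim_compose[OF G_lim filterlim_real_sequentially], of "e/2"] \<open>e > 0\<close>
      by simp
    then obtain K where K: "G (real K) < e / 2" by (auto simp: eventually_sequentially)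
    have "dist (f (real k)) (f (real m)) < e" if "k \<ge> K" "m \<ge> K" for k m
      using dist_triangle_half_l[of "f (real k)" "f (real K)" e "f (real m)"]
        increment[of "real K" "real k"] increment[of "real K" "real m"] K that
      by (auto simp: dist_norm norm_minus_commute)
    then show "\<exists>M. \<forall>m\<ge>M. \<forall>k\<ge>M. dist (f (real m)) (f (real k)) < e" by blast
  qed
  then obtain y where y: "(\<lambda>k. f (real k)) \<longlonglongrightarrow> y"
    using Cauchy_convergent convergent_def by blast
  have "norm (y - f t) \<le> G t" if "t \<ge> 0" for t
  proof (rule tendsto_upperbound)
    show "(\<lambda>k. norm (f (real k) - f t)) \<longlonglongrightarrow> norm (y - f t)"
      by (intro tendsto_intros y)
    show "\<forall>\<^sub>F k in sequentially. norm (f (real k) - f t) \<le> G t"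
      using eventually_ge_at_top[of "nat \<lceil>t\<rceil>"]
      by eventually_elim (use increment that in \<open>auto simp: nat_le_iff ceiling_le_iff\<close>)
  qed simp
  then have "((\<lambda>t. f t - y) \<longlongrightarrow> 0) at_top"
    by (intro tendsto_0_le[OF G_lim, of _ 1] eventually_mono[OF eventually_ge_at_top[of 0]])
      (auto simp: norm_minus_commute intro: order_trans[OF _ abs_ge_self])
  then show ?thesis using Lim_null by blast
qed

text \<open>Moving at speed at most \<open>V\<close> changes the angle to a fixed unit vector \<open>y\<close> at rate at most
  \<open>V\<close>: for a tangent vector \<open>w\<close> at \<open>f\<close> only the part of \<open>y\<close> orthogonal to \<open>f\<close> matters, so
  \<open>\<bar>w \<bullet> y\<bar> \<le> norm w * sqrt (1 - (f \<bullet> y)\<^sup>2)\<close>, and the square root is the one in the derivative of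
  \<open>arccos\<close>. Since \<open>G\<close> decreases at rate \<open>V\<close> and both \<open>G\<close> and the angle end at \<open>0\<close> when \<open>y\<close> is the
  limit, \<open>G t\<close> dominates the angle. The function \<open>arccos\<close> is not differentiable at \<open>\<plusminus>1\<close>; the
  factor \<open>\<mu> < 1\<close> in \<open>arccos (\<mu> * (f \<bullet> y))\<close> keeps the argument away from these points without
  spoiling the rate bound, and tends to \<open>1\<close> at the end.\<close>

lemma sphere_dist_limit_le_remaining_length:
  fixes f f' :: "real \<Rightarrow> 'a::real_inner" and G V :: "real \<Rightarrow> real"
  assumes unit: "\<And>s. t \<le> s \<Longrightarrow> norm (f s) = 1" and y_unit: "norm y = 1"
    and cont: "continuous_on {t..} f"
    and df: "\<And>s. t < s \<Longrightarrow> (f has_vector_derivative f' s) (at s)"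
    and tangent: "\<And>s. t < s \<Longrightarrow> f' s \<bullet> f s = 0"
    and speed: "\<And>s. t < s \<Longrightarrow> norm (f' s) \<le> V s"
    and DERIV_G: "\<And>s. (G has_real_derivative - V s) (at s)"
    and f_lim: "(f \<longlongrightarrow> y) at_top" and G_lim: "(G \<longlongrightarrow> 0) at_top"
  shows "sphere_dist (f t) y \<le> G t"
proof -
  let ?c = "\<lambda>s. f s \<bullet> y"
  have yy: "y \<bullet> y = 1" using y_unit by (simp add: dot_square_norm)
  have ff: "f s \<bullet> f s = 1" if "t \<le> s" for s using unit[OF that] by (simp add: dot_square_norm)
  have c_abs: "\<bar>?c s\<bar> \<le> 1" if "t \<le> s" for s
    using Cauchy_Schwarz_ineq2[of "f s" y] unit[OF that] y_unit by simp
  have cont_G: "continuous_on S G" for S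
    by (rule DERIV_continuous_on) (use DERIV_G has_field_derivative_at_within in blast)
  have shrunk: "arccos (\<mu> * ?c t) \<le> arccos \<mu> + G t" if \<mu>: "0 < \<mu>" "\<mu> < 1" for \<mu>
  proof -
    have small: "\<bar>\<mu> * ?c s\<bar> < 1" if "t \<le> s" for s
    proof -
      have "\<bar>\<mu> * ?c s\<bar> = \<mu> * \<bar>?c s\<bar>" using \<mu> by (simp add: abs_mult)
      also have "\<dots> \<le> \<mu>" using c_abs[OF that] \<mu> by (intro mult_left_le) auto
      finally show ?thesis using \<mu> by simp
    qed
    have "arccos (\<mu> * ?c t) - G t \<le> arccos (\<mu> * ?c T) - G T" if T: "t \<le> T" for T
    proof (rule DERIV_nonneg_imp_increasing_open[OF T])
      fix s assume s: "t < s" "s < T"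
      then have s0: "t \<le> s" by simp
      have tangential: "\<bar>f' s \<bullet> y\<bar> \<le> V s * sqrt (1 - (?c s)\<^sup>2)"
      proof -
        have "(norm (y - ?c s *\<^sub>R f s))\<^sup>2 = 1 - (?c s)\<^sup>2"
          unfolding power2_norm_eq_inner using ff[OF s0] yy
          by (simp add: inner_diff inner_commute power2_eq_square)
        then have "norm (y - ?c s *\<^sub>R f s) = sqrt (1 - (?c s)\<^sup>2)"
          by (metis norm_ge_zero real_sqrt_unique)
        then have "\<bar>f' s \<bullet> (y - ?c s *\<^sub>R f s)\<bar> \<le> norm (f' s) * sqrt (1 - (?c s)\<^sup>2)"
          using Cauchy_Schwarz_ineq2[of "f' s" "y - ?c s *\<^sub>R f s"] by simp
        also have "\<dots> \<le> V s * sqrt (1 - (?c s)\<^sup>2)"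
          using speed[OF s(1)] c_abs[OF s0] by (intro mult_right_mono) (auto simp: abs_square_le_1)
        finally show ?thesis using tangent[OF s(1)] by (simp add: inner_diff_right)
      qed
      \<comment> \<open>Shrinking the cosine costs nothing: \<open>\<mu>\<^sup>2 - \<mu>\<^sup>2 c\<^sup>2 \<le> 1 - \<mu>\<^sup>2 c\<^sup>2\<close>.\<close>
      have shrink: "\<mu> * sqrt (1 - (?c s)\<^sup>2) \<le> sqrt (1 - (\<mu> * ?c s)\<^sup>2)"
      proof (rule real_le_rsqrt)
        have "\<mu>\<^sup>2 \<le> 1" using \<mu> by (simp add: power_le_one)
        moreover have "0 \<le> 1 - (?c s)\<^sup>2" using c_abs[OF s0] by (simp add: abs_square_le_1)
        ultimately show "(\<mu> * sqrt (1 - (?c s)\<^sup>2))\<^sup>2 \<le> 1 - (\<mu> * ?c s)\<^sup>2"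
          by (simp add: power_mult_distrib algebra_simps)
      qed
      have V: "V s \<ge> 0" using speed[OF s(1)] norm_ge_zero order_trans by blast
      have "\<mu> * (f' s \<bullet> y) \<le> \<mu> * (V s * sqrt (1 - (?c s)\<^sup>2))"
        using tangential \<mu> by (intro mult_left_mono) auto
      also have "\<dots> = V s * (\<mu> * sqrt (1 - (?c s)\<^sup>2))" by simp
      also have "\<dots> \<le> V s * sqrt (1 - (\<mu> * ?c s)\<^sup>2)" using shrink V by (rule mult_left_mono)
      finally have num: "\<mu> * (f' s \<bullet> y) \<le> V s * sqrt (1 - (\<mu> * ?c s)\<^sup>2)" .
      have "(?c has_real_derivative f' s \<bullet> y) (at s)"
        using bounded_linear.has_vector_derivative[OF bounded_linear_inner_left df[OF s(1)], of y]
        by (simp add: has_real_derivative_iff_has_vector_derivative)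
      then have "((\<lambda>s. \<mu> * ?c s) has_real_derivative \<mu> * (f' s \<bullet> y)) (at s)"
        by (rule DERIV_cmult)
      moreover have "-1 < \<mu> * ?c s" "\<mu> * ?c s < 1" using small[of s] s0 by auto
      ultimately have "((\<lambda>s. arccos (\<mu> * ?c s)) has_real_derivative
          inverse (- sqrt (1 - (\<mu> * ?c s)\<^sup>2)) * (\<mu> * (f' s \<bullet> y))) (at s)"
        by (intro DERIV_chain2[OF DERIV_arccos])
      from DERIV_diff[OF this DERIV_G[of s]]
      have "((\<lambda>s. arccos (\<mu> * ?c s) - G s) has_real_derivative
          V s - \<mu> * (f' s \<bullet> y) / sqrt (1 - (\<mu> * ?c s)\<^sup>2)) (at s)"
        by (simp add: field_simps)
      moreover have "\<mu> * (f' s \<bullet> y) / sqrt (1 - (\<mu> * ?c s)\<^sup>2) \<le> V s"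
      proof -
        have "0 < sqrt (1 - (\<mu> * ?c s)\<^sup>2)" using small[of s] s0 by (simp add: abs_square_less_1)
        then show ?thesis using num by (simp add: pos_divide_le_eq)
      qed
      ultimately show "\<exists>D. ((\<lambda>s. arccos (\<mu> * ?c s) - G s) has_real_derivative D) (at s) \<and> 0 \<le> D"
        by (intro exI conjI) auto
    next
      have "continuous_on {t..T} (\<lambda>s. \<mu> * ?c s)"
        by (intro continuous_intros continuous_on_subset[OF cont]) auto
      moreover have "\<forall>s\<in>{t..T}. -1 \<le> \<mu> * ?c s \<and> \<mu> * ?c s \<le> 1"
      proof
        fix s assume "s \<in> {t..T}"
        then have "\<bar>\<mu> * ?c s\<bar> < 1" using small by simp
        then show "-1 \<le> \<mu> * ?c s \<and> \<mu> * ?c s \<le> 1" by linarith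
      qed
      ultimately show "continuous_on {t..T} (\<lambda>s. arccos (\<mu> * ?c s) - G s)"
        by (intro continuous_on_diff cont_G continuous_on_arccos)
    qed
    then have ev: "\<forall>\<^sub>F T in at_top. arccos (\<mu> * ?c t) - G t \<le> arccos (\<mu> * ?c T) - G T"
      by (intro eventually_mono[OF eventually_ge_at_top[of t]])
    have "((\<lambda>T. arccos (\<mu> * ?c T) - G T) \<longlongrightarrow> arccos (\<mu> * (y \<bullet> y)) - 0) at_top"
    proof (intro tendsto_diff G_lim)
      have "((\<lambda>T. \<mu> * ?c T) \<longlongrightarrow> \<mu> * (y \<bullet> y)) at_top"
        by (intro tendsto_intros f_lim)
      then show "((\<lambda>T. arccos (\<mu> * ?c T)) \<longlongrightarrow> arccos (\<mu> * (y \<bullet> y))) at_top"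
        by (rule isCont_tendsto_compose[rotated]) (use \<mu> yy in \<open>auto intro!: isCont_arccos\<close>)
    qed
    from tendsto_lowerbound[OF this ev] show ?thesis
      using yy by simp
  qed
  have "arccos (1 * ?c t) - arccos 1 \<le> G t"
  proof (rule tendsto_upperbound[where F = "at_left 1"])
    have "\<forall>\<mu>\<in>{0..1}. -1 \<le> \<mu> * ?c t \<and> \<mu> * ?c t \<le> 1"
    proof
      fix \<mu> :: real assume \<mu>: "\<mu> \<in> {0..1}"
      have "\<bar>\<mu> * ?c t\<bar> = \<mu> * \<bar>?c t\<bar>" unfolding abs_mult using \<mu> by (simp only: abs_of_nonneg atLeastAtMost_iff)
      also have "\<dots> \<le> \<mu>" using c_abs[OF order_refl] \<mu> by (intro mult_left_le) auto
      also have "\<dots> \<le> 1" using \<mu> by simp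
      finally show "-1 \<le> \<mu> * ?c t \<and> \<mu> * ?c t \<le> 1" by linarith
    qed
    then have "continuous_on {0..1} (\<lambda>\<mu>. arccos (\<mu> * ?c t) - arccos \<mu>)"
      by (intro continuous_on_diff continuous_on_arccos continuous_on_mult continuous_on_id continuous_on_const) auto
    then have "((\<lambda>\<mu>. arccos (\<mu> * ?c t) - arccos \<mu>) \<longlongrightarrow> arccos (1 * ?c t) - arccos 1) (at 1 within {0..1})"
      by (rule bspec[OF continuous_on_def[THEN iffD1]]) simp
    then show "((\<lambda>\<mu>. arccos (\<mu> * ?c t) - arccos \<mu>) \<longlongrightarrow> arccos (1 * ?c t) - arccos 1) (at_left 1)"
      using at_within_Icc_at_left[of 0 "1::real"] by simp
    show "\<forall>\<^sub>F \<mu> in at_left 1. arccos (\<mu> * ?c t) - arccos \<mu> \<le> G t"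
      using eventually_at_left_real[of 0 1, simplified]
      by eventually_elim (use shrunk in \<open>auto simp: algebra_simps\<close>)
  qed simp
  then show ?thesis by (simp add: sphere_dist_def)
qed

section \<open>Consensus on the sphere under averaging weights\<close>

text \<open>The weights are functions of time instead of the configuration: along a given solution the
  dependence on the scores turns into a dependence on \<open>t\<close>.\<close>

locale sphere_consensus =
  fixes n :: nat
    and A :: "real \<Rightarrow> nat \<Rightarrow> nat \<Rightarrow> real"
    and x :: "real \<Rightarrow> nat \<Rightarrow> 'a::euclidean_space"
    and a :: real
  assumes n_pos: "n \<ge> 1"
    and a_pos: "a > 0"
    and weight_ge: "\<And>t i j. t \<ge> 0 \<Longrightarrow> i \<in> {1..n} \<Longrightarrow> j \<in> {1..n} \<Longrightarrow> a \<le> A t i j"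
    and weight_sum: "\<And>t i. t \<ge> 0 \<Longrightarrow> i \<in> {1..n} \<Longrightarrow> (\<Sum>j=1..n. A t i j) = 1"
    and unit: "\<And>t i. t \<ge> 0 \<Longrightarrow> i \<in> {1..n} \<Longrightarrow> norm (x t i) = 1"
    and flow: "\<And>t i. t \<ge> 0 \<Longrightarrow> i \<in> {1..n} \<Longrightarrow>
      ((\<lambda>s. x s i) has_vector_derivative
        (\<Sum>j=1..n. A t i j *\<^sub>R (x t j - (x t i \<bullet> x t j) *\<^sub>R x t i))) (at t within {0..})"
begin

abbreviation corr :: "real \<Rightarrow> nat \<Rightarrow> nat \<Rightarrow> real" where
  "corr t i j \<equiv> x t i \<bullet> x t j"

abbreviation velocity :: "real \<Rightarrow> nat \<Rightarrow> 'a" where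
  "velocity t i \<equiv> (\<Sum>j=1..n. A t i j *\<^sub>R (x t j - corr t i j *\<^sub>R x t i))"

text \<open>The part of the derivative of \<open>corr t i j\<close> that is due to the motion of token \<open>i\<close>.\<close>

definition pull :: "real \<Rightarrow> nat \<Rightarrow> nat \<Rightarrow> real" where
  "pull t i j = (\<Sum>k=1..n. A t i k * (corr t k j - corr t i k * corr t i j))"

lemma weight_pos: "t \<ge> 0 \<Longrightarrow> i \<in> {1..n} \<Longrightarrow> j \<in> {1..n} \<Longrightarrow> 0 < A t i j"
  using weight_ge[of t i j] a_pos by linarith

lemma corr_self: "t \<ge> 0 \<Longrightarrow> i \<in> {1..n} \<Longrightarrow> corr t i i = 1"
  using unit[of t i] by (simp add: dot_square_norm)

lemma corr_abs_le: "t \<ge> 0 \<Longrightarrow> i \<in> {1..n} \<Longrightarrow> j \<in> {1..n} \<Longrightarrow> \<bar>corr t i j\<bar> \<le> 1"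
  using Cauchy_Schwarz_ineq2[of "x t i" "x t j"] unit[of t i] unit[of t j] by simp

lemma continuous_on_token: "i \<in> {1..n} \<Longrightarrow> continuous_on {0..} (\<lambda>t. x t i)"
  unfolding continuous_on_eq_continuous_within
  using has_vector_derivative_continuous[OF flow] by auto

lemma inner_velocity: "y \<bullet> velocity t i = (\<Sum>k=1..n. A t i k * (x t k \<bullet> y - corr t i k * (x t i \<bullet> y)))"
  by (simp add: inner_sum_right inner_diff_right inner_commute)

lemma DERIV_inner_const:
  assumes "t \<ge> 0" "i \<in> {1..n}"
  shows "((\<lambda>s. x s i \<bullet> y) has_real_derivative velocity t i \<bullet> y) (at t within {0..})"
  using bounded_linear.has_vector_derivative[OF bounded_linear_inner_left flow[OF assms], of y]
  by (simp add: has_real_derivative_iff_has_vector_derivative)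

lemma DERIV_corr:
  assumes t: "t \<ge> 0" and i: "i \<in> {1..n}" and j: "j \<in> {1..n}"
  shows "((\<lambda>s. corr s i j) has_real_derivative pull t i j + pull t j i) (at t within {0..})"
proof -
  have "((\<lambda>s. corr s i j) has_vector_derivative
      x t i \<bullet> velocity t j + velocity t i \<bullet> x t j) (at t within {0..})"
    by (rule bounded_bilinear.has_vector_derivative[OF bounded_bilinear_inner flow flow]) (use assms in auto)
  moreover have "x t i \<bullet> velocity t j = pull t j i" "velocity t i \<bullet> x t j = pull t i j"
    using inner_velocity[of "x t i" t j] inner_velocity[of "x t j" t i]
    by (simp_all add: pull_def inner_commute)
  ultimately show ?thesis
    by (simp add: has_real_derivative_iff_has_vector_derivative add.commute)
qed

text \<open>At a minimal pair \<open>m = corr t i j\<close> token \<open>k\<close> contributes \<open>corr k j - corr i k * m \<ge> m (1 - corr i k)\<close>,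
  which is nonnegative when \<open>m \<ge> 0\<close>; token \<open>j\<close> itself contributes \<open>1 - m\<^sup>2\<close>. The minimum with \<open>2 m\<close> measures
  the possible damage when \<open>m\<close> is slightly negative, as needed to show that the minimum never
  becomes negative.\<close>

lemma pull_lower_bound:
  assumes t: "t \<ge> 0" and i: "i \<in> {1..n}" and j: "j \<in> {1..n}"
    and min: "\<And>k l. k \<in> {1..n} \<Longrightarrow> l \<in> {1..n} \<Longrightarrow> corr t i j \<le> corr t k l"
  shows "a * (1 - (corr t i j)\<^sup>2) + min 0 (2 * corr t i j) \<le> pull t i j"
proof -
  let ?m = "corr t i j"
  have m: "\<bar>?m\<bar> \<le> 1" using corr_abs_le[OF t i j] .
  then have m2: "0 \<le> 1 - ?m\<^sup>2" by (simp add: abs_square_le_1)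
  have rest: "A t i k * min 0 (2 * ?m) \<le> A t i k * (corr t k j - corr t i k * ?m)"
    if k: "k \<in> {1..n}" for k
  proof (intro mult_left_mono)
    have c: "-1 \<le> corr t i k" "corr t i k \<le> 1" using corr_abs_le[OF t i k] by auto
    have "min 0 (2 * ?m) \<le> ?m * (1 - corr t i k)"
    proof (cases "?m \<ge> 0")
      case True
      then have "0 \<le> ?m * (1 - corr t i k)" using c by simp
      then show ?thesis by simp
    next
      case False
      then have "2 * ?m \<le> ?m * (1 - corr t i k)"
        using c mult_left_mono_neg[of "1 - corr t i k" 2 ?m] by simp
      then show ?thesis by simp
    qed
    then show "min 0 (2 * ?m) \<le> corr t k j - corr t i k * ?m"
      using min[OF k j] by (simp add: algebra_simps)
  qed (use weight_pos[OF t i k] in simp)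
  have "(\<Sum>k\<in>{1..n} - {j}. A t i k) \<le> (\<Sum>k=1..n. A t i k)"
    by (intro sum_mono2) (auto intro!: less_imp_le weight_pos t i[simplified])
  then have le1: "(\<Sum>k\<in>{1..n} - {j}. A t i k) \<le> 1" using weight_sum[OF t i] by simp
  have "min 0 (2 * ?m) \<le> (\<Sum>k\<in>{1..n} - {j}. A t i k) * min 0 (2 * ?m)"
    using mult_right_mono_neg[OF le1, of "min 0 (2 * ?m)"] by simp
  also have "\<dots> \<le> (\<Sum>k\<in>{1..n} - {j}. A t i k * (corr t k j - corr t i k * ?m))"
    unfolding sum_distrib_right by (intro sum_mono rest) auto
  finally have others: "min 0 (2 * ?m) \<le> \<dots>" .
  have "a * (1 - ?m\<^sup>2) \<le> A t i j * (1 - ?m\<^sup>2)"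
    by (intro mult_right_mono weight_ge t i j m2)
  then have "a * (1 - ?m\<^sup>2) \<le> A t i j * (corr t j j - corr t i j * ?m)"
    using corr_self[OF t j] by (simp add: power2_eq_square)
  then show ?thesis
    unfolding pull_def using others j by (subst sum.remove[of _ j]) auto
qed

lemma DERIV_minimal_corr_ge:
  assumes t: "t \<ge> 0" and i: "i \<in> {1..n}" and j: "j \<in> {1..n}"
    and min: "\<And>k l. k \<in> {1..n} \<Longrightarrow> l \<in> {1..n} \<Longrightarrow> corr t i j \<le> corr t k l"
  shows "2 * a * (1 - (corr t i j)\<^sup>2) + min 0 (4 * corr t i j) \<le> pull t i j + pull t j i"
  using pull_lower_bound[OF t i j min] pull_lower_bound[OF t j i] min
  by (simp add: inner_commute min_def split: if_splits)

text \<open>At a minimum \<open>- \<epsilon>\<close> the mutual attraction \<open>2 a (1 - \<epsilon>\<^sup>2)\<close> outweighs the damage \<open>4 \<epsilon>\<close> once \<open>\<epsilon>\<close> is small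
  compared with \<open>a\<close>, so the minimum never comes down to such a constant barrier.\<close>

lemma hemisphere_invariant:
  assumes start: "\<And>i j. i \<in> {1..n} \<Longrightarrow> j \<in> {1..n} \<Longrightarrow> 0 \<le> corr 0 i j"
    and t: "t \<ge> 0" and i: "i \<in> {1..n}" and j: "j \<in> {1..n}"
  shows "0 \<le> corr t i j"
proof (rule ccontr)
  assume neg: "\<not> 0 \<le> corr t i j"
  \<comment> \<open>The bounds \<open>a / 4\<close> and \<open>1 / 2\<close> give \<open>4 \<epsilon> \<le> a\<close> and \<open>2 a (1 - \<epsilon>\<^sup>2) \<ge> 3 a / 2\<close>.\<close>
  define \<epsilon> where "\<epsilon> = min (- corr t i j) (min (a / 4) (1 / 2))"
  have \<epsilon>: "0 < \<epsilon>" "\<epsilon> \<le> - corr t i j" "\<epsilon> \<le> a / 4" "\<epsilon> \<le> 1 / 2"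
    using neg a_pos by (auto simp: \<epsilon>_def)
  have "\<epsilon>\<^sup>2 \<le> (1/2)\<^sup>2" using \<epsilon> by (intro power_mono) auto
  then have "a * (3/4) \<le> a * (1 - \<epsilon>\<^sup>2)"
    using a_pos by (intro mult_left_mono) (auto simp: power2_eq_square)
  then have gap: "2 * a * (1 - \<epsilon>\<^sup>2) - 4 * \<epsilon> > 0" using \<epsilon> a_pos by linarith
  have "- \<epsilon> < (case (i, j) of (i, j) \<Rightarrow> \<lambda>t. corr t i j) t"
  proof (rule first_contact[where I = "{1..n} \<times> {1..n}" and b = "\<lambda>_. - \<epsilon>" and b' = "\<lambda>_. 0"
        and f = "\<lambda>(i, j) t. corr t i j" and f' = "\<lambda>(i, j) t. pull t i j + pull t j i"])
    fix ij s
    assume ij: "ij \<in> {1..n} \<times> {1..n}" and s: "s > 0"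
      and hit: "(case ij of (i, j) \<Rightarrow> \<lambda>t. corr t i j) s = - \<epsilon>"
      and least: "\<forall>kl\<in>{1..n} \<times> {1..n}. - \<epsilon> \<le> (case kl of (i, j) \<Rightarrow> \<lambda>t. corr t i j) s"
    obtain k l where kl: "ij = (k, l)" "k \<in> {1..n}" "l \<in> {1..n}" "corr s k l = - \<epsilon>"
      using ij hit by auto
    have "2 * a * (1 - (corr s k l)\<^sup>2) + min 0 (4 * corr s k l) \<le> pull s k l + pull s l k"
      using s kl least by (intro DERIV_minimal_corr_ge) auto
    then show "0 < (case ij of (i, j) \<Rightarrow> \<lambda>t. pull t i j + pull t j i) s"
      using kl gap \<epsilon> by simp
  qed (use assms \<epsilon> DERIV_corr in \<open>auto intro: less_le_trans[of _ 0]\<close>)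
  then show False using \<epsilon> by simp
qed

text \<open>The barrier \<open>cos_half_tan (q \<epsilon> s)\<close> solves \<open>m' = 2 (a - \<epsilon>) (1 - m\<^sup>2)\<close> and starts strictly below all inner
  products. The minimal inner product grows at least at rate \<open>2 a (1 - m\<^sup>2)\<close>, which is strictly faster
  since \<open>m < 1\<close> on the barrier. The invariance of \<open>m \<ge> 0\<close> is established beforehand
  because for \<open>q0 = 1\<close> the perturbed barrier starts below \<open>0\<close>.\<close>

lemma acute_contraction:
  assumes q0: "0 \<le> q0"
    and acute: "\<And>i j. i \<in> {1..n} \<Longrightarrow> j \<in> {1..n} \<Longrightarrow> 0 \<le> corr 0 i j"
    and start: "\<And>i j. i \<in> {1..n} \<Longrightarrow> j \<in> {1..n} \<Longrightarrow> cos_half_tan q0 \<le> corr 0 i j"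
    and t: "t \<ge> 0" and i: "i \<in> {1..n}" and j: "j \<in> {1..n}"
  shows "cos_half_tan (q0 * exp (- 2 * a * t)) \<le> corr t i j"
proof -
  define q where "q \<epsilon> s = (q0 + \<epsilon>) * exp (- 2 * (a - \<epsilon>) * s)" for \<epsilon> s
  have strict: "cos_half_tan (q \<epsilon> t) < (case (i, j) of (i, j) \<Rightarrow> \<lambda>t. corr t i j) t" if \<epsilon>: "\<epsilon> > 0" for \<epsilon>
  proof (rule first_contact[where I = "{1..n} \<times> {1..n}"
        and b' = "\<lambda>s. 2 * (a - \<epsilon>) * (1 - (cos_half_tan (q \<epsilon> s))\<^sup>2)"
        and f = "\<lambda>(i, j) t. corr t i j" and f' = "\<lambda>(i, j) t. pull t i j + pull t j i"])
    show "((\<lambda>s. cos_half_tan (q \<epsilon> s)) has_real_derivative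
        2 * (a - \<epsilon>) * (1 - (cos_half_tan (q \<epsilon> s))\<^sup>2)) (at s within {0..})" for s
      unfolding q_def by (rule DERIV_cos_half_tan_exp)
  next
    fix ij assume "ij \<in> {1..n} \<times> {1..n}"
    moreover have "cos_half_tan (q \<epsilon> 0) < cos_half_tan q0"
      using \<epsilon> q0 by (intro cos_half_tan_antimono) (auto simp: q_def)
    ultimately show "cos_half_tan (q \<epsilon> 0) < (case ij of (i, j) \<Rightarrow> \<lambda>t. corr t i j) 0"
      using start by (auto intro: less_le_trans)
  next
    fix ij s
    assume ij: "ij \<in> {1..n} \<times> {1..n}" and s: "s > 0"
      and hit: "(case ij of (i, j) \<Rightarrow> \<lambda>t. corr t i j) s = cos_half_tan (q \<epsilon> s)"
      and least: "\<forall>kl\<in>{1..n} \<times> {1..n}. cos_half_tan (q \<epsilon> s) \<le> (case kl of (i, j) \<Rightarrow> \<lambda>t. corr t i j) s"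
    obtain k l where kl: "ij = (k, l)" "k \<in> {1..n}" "l \<in> {1..n}" "corr s k l = cos_half_tan (q \<epsilon> s)"
      using ij hit by auto
    have nonneg: "0 \<le> corr s k l" by (rule hemisphere_invariant) (use acute kl s in auto)
    have "q \<epsilon> s > 0" using \<epsilon> q0 by (simp add: q_def)
    then have "corr s k l < 1" using cos_half_tan_less_1 kl by simp
    then have "(corr s k l)\<^sup>2 < 1" using nonneg by (simp add: abs_square_less_1)
    then have "2 * (a - \<epsilon>) * (1 - (corr s k l)\<^sup>2) < 2 * a * (1 - (corr s k l)\<^sup>2)"
      using \<epsilon> by (intro mult_strict_right_mono) auto
    also have "\<dots> \<le> pull s k l + pull s l k"
    proof -
      have "2 * a * (1 - (corr s k l)\<^sup>2) + min 0 (4 * corr s k l) \<le> pull s k l + pull s l k"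
        using s kl least by (intro DERIV_minimal_corr_ge) auto
      then show ?thesis using nonneg by simp
    qed
    finally show "2 * (a - \<epsilon>) * (1 - (cos_half_tan (q \<epsilon> s))\<^sup>2)
        < (case ij of (i, j) \<Rightarrow> \<lambda>t. pull t i j + pull t j i) s"
      using kl by simp
  qed (use t i j DERIV_corr in auto)
  have "cos_half_tan (q 0 t) \<le> corr t i j"
  proof (rule le_at_zero_perturbation)
    show "isCont (\<lambda>\<epsilon>. cos_half_tan (q \<epsilon> t)) 0"
      unfolding cos_half_tan_def q_def using one_plus_square_pos(2)
      by (intro continuous_intros) auto
  qed (use strict in \<open>auto intro: less_imp_le\<close>)
  then show ?thesis by (simp add: q_def)
qed

text \<open>The tangential part of the vector to \<open>x t j\<close> has squared length \<open>1 - c\<^sup>2 \<le> 2 (1 - c)\<close>, the squared chord;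
  the chord bound \<open>2 q / sqrt (q\<^sup>2 + 1)\<close>, and not the smaller tangential length, is the one that
  integrates to \<open>arsinh\<close>.\<close>

lemma speed_bound:
  assumes t: "t \<ge> 0" and i: "i \<in> {1..n}" and q: "q \<ge> 0"
    and near: "\<And>j. j \<in> {1..n} \<Longrightarrow> cos_half_tan q \<le> corr t i j"
  shows "norm (velocity t i) \<le> 2 * q / sqrt (q\<^sup>2 + 1)"
proof -
  let ?V = "2 * q / sqrt (q\<^sup>2 + 1)"
  have summand: "norm (x t j - corr t i j *\<^sub>R x t i) \<le> ?V" if j: "j \<in> {1..n}" for j
  proof (rule power2_le_imp_le)
    let ?c = "corr t i j"
    have "(norm (x t j - ?c *\<^sub>R x t i))\<^sup>2 = 1 - ?c\<^sup>2"
      unfolding power2_norm_eq_inner using corr_self[OF t i] corr_self[OF t j]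
      by (simp add: inner_diff inner_commute power2_eq_square)
    also have "\<dots> = (1 - ?c) * (1 + ?c)" by (simp add: power2_eq_square algebra_simps)
    also have "\<dots> \<le> (1 - ?c) * 2"
      using corr_abs_le[OF t i j] by (intro mult_left_mono) auto
    also have "\<dots> \<le> (1 - cos_half_tan q) * 2" using near[OF j] by simp
    also have "\<dots> = ?V\<^sup>2"
      using one_plus_square_pos[of q]
      by (simp add: one_minus_cos_half_tan power_divide power_mult_distrib add.commute)
    finally show "(norm (x t j - ?c *\<^sub>R x t i))\<^sup>2 \<le> ?V\<^sup>2" .
  qed (use q in simp)
  have "norm (velocity t i) \<le> (\<Sum>j=1..n. norm (A t i j *\<^sub>R (x t j - corr t i j *\<^sub>R x t i)))"
    by (rule norm_sum)
  also have "\<dots> \<le> (\<Sum>j=1..n. A t i j * ?V)"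
  proof (rule sum_mono)
    fix j assume j: "j \<in> {1..n}"
    show "norm (A t i j *\<^sub>R (x t j - corr t i j *\<^sub>R x t i)) \<le> A t i j * ?V"
      using mult_left_mono[OF summand[OF j], of "A t i j"] weight_pos[OF t i j] by simp
  qed
  also have "\<dots> = ?V" using weight_sum[OF t i] by (simp flip: sum_distrib_right sum_divide_distrib)
  finally show ?thesis .
qed

text \<open>By \<open>speed_bound\<close> the speed of every token is at most the rate \<open>V\<close> at which \<open>G = arsinh q / a\<close> decreases
  to \<open>0\<close>, so \<open>G t\<close> bounds the length that remains after time \<open>t\<close>.\<close>

lemma consensus_rate:
  assumes q0: "q0 \<ge> 0"
    and near: "\<And>t i j. t \<ge> 0 \<Longrightarrow> i \<in> {1..n} \<Longrightarrow> j \<in> {1..n} \<Longrightarrow>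
      cos_half_tan (q0 * exp (- 2 * a * t)) \<le> corr t i j"
  shows "\<exists>y\<in>sphere 0 1. (\<forall>i\<in>{1..n}. ((\<lambda>t. x t i) \<longlongrightarrow> y) at_top) \<and>
    (\<forall>i\<in>{1..n}. \<forall>t\<ge>0. sphere_dist (x t i) y \<le> arsinh (q0 * exp (- 2 * a * t)) / a)"
proof -
  define q where "q t = q0 * exp (- 2 * a * t)" for t
  define G where "G t = arsinh (q t) / a" for t
  define V where "V t = 2 * q t / sqrt ((q t)\<^sup>2 + 1)" for t
  have q_nonneg: "q t \<ge> 0" for t using q0 by (simp add: q_def)
  have G_nonneg: "G t \<ge> 0" for t
    using q_nonneg[of t] a_pos arsinh_real_strict_mono[of 0 "q t"]
    by (cases "q t = 0") (simp_all add: G_def less_imp_le)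
  have DERIV_G: "(G has_real_derivative - V t) (at t)" for t
    unfolding G_def[abs_def] V_def q_def by (rule DERIV_arsinh_exp) (use a_pos in simp)
  have cont_G: "continuous_on S G" for S
    by (rule DERIV_continuous_on) (use DERIV_G has_field_derivative_at_within in blast)
  have q_lim: "(q \<longlongrightarrow> 0) at_top"
    unfolding q_def[abs_def] using a_pos by real_asymp
  have G_lim: "(G \<longlongrightarrow> 0) at_top"
  proof -
    have "((\<lambda>t. arsinh (q t) / a) \<longlongrightarrow> arsinh 0 / a) at_top"
      using a_pos by (intro tendsto_intros q_lim) auto
    then show ?thesis by (simp add: G_def[abs_def])
  qed
  have speed: "norm (velocity t i) \<le> V t" if "t \<ge> 0" "i \<in> {1..n}" for t i
    unfolding V_def by (rule speed_bound) (use that near q_nonneg in \<open>auto simp: q_def\<close>)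
  have flow_at: "((\<lambda>s. x s i) has_vector_derivative velocity t i) (at t)" if "t > 0" "i \<in> {1..n}" for t i
    using flow[of t i] that at_within_interior[of t "{0..}"] by simp
  have increment: "norm (x s i - x t i) \<le> G t" if "0 \<le> t" "t \<le> s" "i \<in> {1..n}" for s t i
  proof (cases "t = s")
    case False
    have "norm (x s i - x t i) \<le> (- G s) - (- G t)"
    proof (rule differentiable_bound_general[where f' = "\<lambda>r. velocity r i"])
      show "continuous_on {t..s} (\<lambda>t. x t i)"
        by (rule continuous_on_subset[OF continuous_on_token]) (use that in auto)
      show "((\<lambda>t. - G t) has_vector_derivative V r) (at r)" for r
        using DERIV_minus[OF DERIV_G[of r]] by (simp add: has_real_derivative_iff_has_vector_derivative)
    qed (use that False flow_at speed cont_G in \<open>auto intro!: continuous_on_minus\<close>)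
    then show ?thesis using G_nonneg[of s] by simp
  qed (use G_nonneg in simp)
  have "\<exists>y. ((\<lambda>t. x t i) \<longlongrightarrow> y) at_top" if "i \<in> {1..n}" for i
    using convergent_if_increments_vanish[OF increment G_lim] that by blast
  then obtain Y where Y: "\<And>i. i \<in> {1..n} \<Longrightarrow> ((\<lambda>t. x t i) \<longlongrightarrow> Y i) at_top" by metis
  have Y_unit: "norm (Y i) = 1" if i: "i \<in> {1..n}" for i
  proof (rule tendsto_unique[OF _ tendsto_norm[OF Y[OF i]]])
    show "((\<lambda>t. norm (x t i)) \<longlongrightarrow> 1) at_top"
      using unit i by (intro tendsto_eventually eventually_mono[OF eventually_ge_at_top[of 0]]) auto
  qed simp
  define y where "y = Y 1"
  have one: "1 \<in> {1..n}" using n_pos by simp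
  have y_unit: "norm y = 1" unfolding y_def by (rule Y_unit[OF one])
  have lim: "((\<lambda>t. x t i) \<longlongrightarrow> y) at_top" if i: "i \<in> {1..n}" for i
  proof -
    have "((\<lambda>t. corr t i 1) \<longlongrightarrow> Y i \<bullet> y) at_top"
      unfolding y_def by (intro tendsto_inner Y i one)
    moreover have "((\<lambda>t. cos_half_tan (q t)) \<longlongrightarrow> cos_half_tan 0) at_top"
      unfolding cos_half_tan_def by (intro tendsto_intros q_lim) auto
    moreover have "\<forall>\<^sub>F t in at_top. cos_half_tan (q t) \<le> corr t i 1"
      using near[OF _ i one] by (intro eventually_mono[OF eventually_ge_at_top[of 0]]) (auto simp: q_def)
    ultimately have "cos_half_tan 0 \<le> Y i \<bullet> y"
      by (intro tendsto_le[of at_top]) auto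
    moreover have "(norm (Y i - y))\<^sup>2 = (norm (Y i))\<^sup>2 + (norm y)\<^sup>2 - 2 * (Y i \<bullet> y)"
      by (simp add: power2_norm_eq_inner inner_diff inner_commute)
    ultimately have "(norm (Y i - y))\<^sup>2 \<le> 0" using y_unit Y_unit[OF i] by (simp add: cos_half_tan_def)
    then show ?thesis using Y[OF i] by simp
  qed
  have rate: "sphere_dist (x t i) y \<le> G t" if t: "t \<ge> 0" and i: "i \<in> {1..n}" for t i
  proof (rule sphere_dist_limit_le_remaining_length[where f = "\<lambda>s. x s i" and f' = "\<lambda>s. velocity s i" and V = V])
    fix s assume s: "t < s"
    then show "((\<lambda>s. x s i) has_vector_derivative velocity s i) (at s)"
      using flow_at t i by simp
    show "velocity s i \<bullet> x s i = 0"
      using inner_velocity[of "x s i" s i] corr_self[of s i] s t i by (simp add: inner_commute)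
    show "norm (velocity s i) \<le> V s" using speed s t i by simp
  next
    show "continuous_on {t..} (\<lambda>s. x s i)"
      by (rule continuous_on_subset[OF continuous_on_token[OF i]]) (use t in auto)
  qed (use t i unit y_unit lim G_lim DERIV_G in auto)
  show ?thesis
    using y_unit lim rate by (intro bexI[of _ y]) (auto simp: G_def q_def)
qed

text \<open>All phases lie ahead of \<open>\<phi> i\<close> by at most \<open>pi\<close>, so nothing pulls token \<open>i\<close> back, and the token at the far end alone
  pulls with \<open>a * sin D\<close>. Applied to \<open>- \<phi>\<close> it describes the other end of the arc.\<close>

lemma extreme_phase_speed:
  assumes t: "t \<ge> 0" and i: "i \<in> {1..n}" and j: "j \<in> {1..n}"
    and D: "0 \<le> D" "D \<le> pi"
    and range: "\<And>k. k \<in> {1..n} \<Longrightarrow> \<phi> i \<le> \<phi> k \<and> \<phi> k \<le> \<phi> i + D"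
    and far: "\<phi> j = \<phi> i + D"
  shows "a * sin D \<le> (\<Sum>k=1..n. A t i k * sin (\<phi> k - \<phi> i))"
proof -
  have "0 \<le> sin D" using D by (rule sin_ge_zero)
  then have "a * sin D \<le> A t i j * sin (\<phi> j - \<phi> i)"
    using weight_ge[OF t i j] far by (simp add: mult_right_mono)
  also have "\<dots> \<le> (\<Sum>k=1..n. A t i k * sin (\<phi> k - \<phi> i))"
  proof (rule member_le_sum[OF j])
    fix k assume "k \<in> {1..n} - {j}"
    then have k: "k \<in> {1..n}" by simp
    have "0 \<le> sin (\<phi> k - \<phi> i)"
      using range[OF k] D by (intro sin_ge_zero) auto
    then show "0 \<le> A t i k * sin (\<phi> k - \<phi> i)" using weight_pos[OF t i k] by simp
  qed simp
  finally show ?thesis .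
qed

text \<open>In the plane the velocity of token \<open>i\<close> is \<open>\<rho> t i\<close> times its quarter turn, so a lift is obtained by integrating \<open>\<rho>\<close>.
  That the integral is a lift follows from \<open>cos \<Theta> * u + sin \<Theta> * v\<close> being constantly \<open>1\<close>: two
  unit vectors with inner product \<open>1\<close> coincide. Continuity of the weights serves to integrate \<open>\<rho>\<close>.\<close>

lemma phase_lift:
  assumes e: "norm e1 = 1" "norm e2 = 1" "e1 \<bullet> e2 = 0"
    and plane: "\<And>z. z = (z \<bullet> e1) *\<^sub>R e1 + (z \<bullet> e2) *\<^sub>R e2"
    and cont: "\<And>i j. i \<in> {1..n} \<Longrightarrow> j \<in> {1..n} \<Longrightarrow> continuous_on {0..} (\<lambda>t. A t i j)"
    and start: "\<And>i. i \<in> {1..n} \<Longrightarrow> x 0 i = cos (\<theta> i) *\<^sub>R e1 + sin (\<theta> i) *\<^sub>R e2"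
  obtains \<Theta> where
    "\<And>i. \<Theta> 0 i = \<theta> i"
    "\<And>t i j. t \<ge> 0 \<Longrightarrow> i \<in> {1..n} \<Longrightarrow> j \<in> {1..n} \<Longrightarrow> corr t i j = cos (\<Theta> t i - \<Theta> t j)"
    "\<And>t i. t \<ge> 0 \<Longrightarrow> i \<in> {1..n} \<Longrightarrow> ((\<lambda>s. \<Theta> s i) has_real_derivative
       (\<Sum>k=1..n. A t i k * sin (\<Theta> t k - \<Theta> t i))) (at t within {0..})"
proof -
  define u where "u t i = x t i \<bullet> e1" for t i
  define v where "v t i = x t i \<bullet> e2" for t i
  define \<rho> where "\<rho> t i = (\<Sum>k=1..n. A t i k * (u t i * v t k - v t i * u t k))" for t i
  define \<Theta> where "\<Theta> t i = \<theta> i + integral {0..t} (\<lambda>s. \<rho> s i)" for t i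
  have corr_uv: "corr t i j = u t i * u t j + v t i * v t j" for t i j
    by (subst plane[of "x t j"]) (simp add: u_def v_def inner_add_right)
  have uv1: "(u t i)\<^sup>2 + (v t i)\<^sup>2 = 1" if "t \<ge> 0" "i \<in> {1..n}" for t i
    using corr_uv[of t i i] corr_self[OF that] by (simp add: power2_eq_square)
  have vel1: "velocity t i \<bullet> e1 = - v t i * \<rho> t i" if t: "t \<ge> 0" and i: "i \<in> {1..n}" for t i
  proof -
    have "u t k - corr t i k * u t i = - v t i * (u t i * v t k - v t i * u t k)" for k
    proof -
      have "u t k - corr t i k * u t i = u t k * ((u t i)\<^sup>2 + (v t i)\<^sup>2) - corr t i k * u t i"
        using uv1[OF that] by simp
      then show ?thesis by (simp add: corr_uv power2_eq_square algebra_simps)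
    qed
    then have "(\<Sum>k=1..n. A t i k * (u t k - corr t i k * u t i)) = - v t i * \<rho> t i"
      by (simp add: \<rho>_def sum_distrib_left mult.left_commute)
    then show ?thesis
      using inner_velocity[of e1 t i] by (simp only: u_def inner_commute[of "velocity t i"])
  qed
  have vel2: "velocity t i \<bullet> e2 = u t i * \<rho> t i" if t: "t \<ge> 0" and i: "i \<in> {1..n}" for t i
  proof -
    have "v t k - corr t i k * v t i = u t i * (u t i * v t k - v t i * u t k)" for k
    proof -
      have "v t k - corr t i k * v t i = v t k * ((u t i)\<^sup>2 + (v t i)\<^sup>2) - corr t i k * v t i"
        using uv1[OF that] by simp
      then show ?thesis by (simp add: corr_uv power2_eq_square algebra_simps)
    qed
    then have "(\<Sum>k=1..n. A t i k * (v t k - corr t i k * v t i)) = u t i * \<rho> t i"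
      by (simp add: \<rho>_def sum_distrib_left mult.left_commute)
    then show ?thesis
      using inner_velocity[of e2 t i] by (simp only: v_def inner_commute[of "velocity t i"])
  qed
  have du: "((\<lambda>s. u s i) has_real_derivative - v t i * \<rho> t i) (at t within {0..})"
    if "t \<ge> 0" "i \<in> {1..n}" for t i
    using DERIV_inner_const[OF that, of e1] vel1[OF that] by (simp add: u_def)
  have dv: "((\<lambda>s. v s i) has_real_derivative u t i * \<rho> t i) (at t within {0..})"
    if "t \<ge> 0" "i \<in> {1..n}" for t i
    using DERIV_inner_const[OF that, of e2] vel2[OF that] by (simp add: v_def)
  have cont_rho: "continuous_on {0..} (\<lambda>s. \<rho> s i)" if i: "i \<in> {1..n}" for i
    unfolding \<rho>_def
    by (intro continuous_intros cont i) (auto intro!: DERIV_continuous_on du dv i[simplified])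
  have dTheta: "((\<lambda>s. \<Theta> s i) has_real_derivative \<rho> t i) (at t within {0..})"
    if t: "t \<ge> 0" and i: "i \<in> {1..n}" for t i
  proof -
    have "((\<lambda>s. integral {0..s} (\<lambda>s. \<rho> s i)) has_real_derivative \<rho> t i) (at t within {0..t + 1})"
      by (rule integral_has_real_derivative)
        (use t continuous_on_subset[OF cont_rho[OF i]] in auto)
    moreover have "at t within {0..t + 1} = at t within {0..}"
      using t by (intro at_within_nhd[of _ "{..<t + 1}"]) auto
    ultimately show ?thesis
      unfolding \<Theta>_def by (auto intro!: derivative_eq_intros)
  qed
  have \<Theta>_0: "\<Theta> 0 i = \<theta> i" for i by (simp add: \<Theta>_def)
  have lift: "u t i = cos (\<Theta> t i) \<and> v t i = sin (\<Theta> t i)" if t: "t \<ge> 0" and i: "i \<in> {1..n}" for t i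
  proof -
    let ?P = "\<lambda>t. u t i * cos (\<Theta> t i) + v t i * sin (\<Theta> t i)"
    have "\<exists>c. \<forall>t\<in>{0..}. ?P t = c"
    proof (rule has_field_derivative_zero_constant)
      fix s :: real assume "s \<in> {0..}"
      then have s: "s \<ge> 0" by simp
      show "(?P has_real_derivative 0) (at s within {0..})"
        by (rule derivative_eq_intros du[OF s i] dv[OF s i] dTheta[OF s i] refl)+
          (simp add: algebra_simps)
    qed simp
    moreover have "?P 0 = 1"
    proof -
      have "u 0 i = cos (\<theta> i)" "v 0 i = sin (\<theta> i)"
        using e by (simp_all add: u_def v_def start[OF i] inner_add_left inner_commute[of e2 e1] dot_square_norm)
      then show ?thesis using sin_cos_squared_add[of "\<theta> i"] by (simp add: \<Theta>_0 power2_eq_square)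
    qed
    ultimately have "?P t = 1" using t by (metis atLeast_iff order_refl)
    moreover have "(u t i - cos (\<Theta> t i))\<^sup>2 + (v t i - sin (\<Theta> t i))\<^sup>2
        = ((u t i)\<^sup>2 + (v t i)\<^sup>2) + ((sin (\<Theta> t i))\<^sup>2 + (cos (\<Theta> t i))\<^sup>2) - 2 * ?P t"
      by (simp add: power2_eq_square algebra_simps)
    ultimately have "(u t i - cos (\<Theta> t i))\<^sup>2 + (v t i - sin (\<Theta> t i))\<^sup>2 = 0"
      using uv1[OF t i] by simp
    then show ?thesis by (simp add: sum_power2_eq_zero_iff)
  qed
  show thesis
  proof (rule that)
    fix t i j assume t: "t \<ge> (0::real)" and i: "i \<in> {1..n}" and j: "j \<in> {1..n}"
    show "corr t i j = cos (\<Theta> t i - \<Theta> t j)"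
      using lift[OF t i] lift[OF t j] by (simp add: corr_uv cos_diff)
  next
    fix t i assume t: "t \<ge> (0::real)" and i: "i \<in> {1..n}"
    have "\<rho> t i = (\<Sum>k=1..n. A t i k * sin (\<Theta> t k - \<Theta> t i))"
      unfolding \<rho>_def
    proof (intro sum.cong refl)
      fix k assume k: "k \<in> {1..n}"
      show "A t i k * (u t i * v t k - v t i * u t k) = A t i k * sin (\<Theta> t k - \<Theta> t i)"
        using lift[OF t i] lift[OF t k] by (simp add: sin_diff)
    qed
    then show "((\<lambda>s. \<Theta> s i) has_real_derivative
       (\<Sum>k=1..n. A t i k * sin (\<Theta> t k - \<Theta> t i))) (at t within {0..})"
      using dTheta[OF t i] by simp
  qed (fact \<Theta>_0)
qed

text \<open>Phase differences are compared with the barrier \<open>- 2 arctan (q \<epsilon> s)\<close>. A pair that touches it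
  consists of the two ends of the arc, both of which move inwards with speed at least \<open>a * sin D\<close>. Working with
  lifted phases makes an initial arc of any width below \<open>pi\<close> admissible.\<close>

lemma arc_contraction:
  assumes q0: "0 \<le> q0"
    and e: "norm e1 = 1" "norm e2 = 1" "e1 \<bullet> e2 = 0"
    and plane: "\<And>z. z = (z \<bullet> e1) *\<^sub>R e1 + (z \<bullet> e2) *\<^sub>R e2"
    and cont: "\<And>i j. i \<in> {1..n} \<Longrightarrow> j \<in> {1..n} \<Longrightarrow> continuous_on {0..} (\<lambda>t. A t i j)"
    and start: "\<And>i. i \<in> {1..n} \<Longrightarrow> x 0 i = cos (\<theta> i) *\<^sub>R e1 + sin (\<theta> i) *\<^sub>R e2"
    and arc: "\<And>i j. i \<in> {1..n} \<Longrightarrow> j \<in> {1..n} \<Longrightarrow> \<theta> i - \<theta> j \<le> 2 * arctan q0"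
    and t: "t \<ge> 0" and i: "i \<in> {1..n}" and j: "j \<in> {1..n}"
  shows "cos_half_tan (q0 * exp (- 2 * a * t)) \<le> corr t i j"
proof -
  obtain \<Theta> where \<Theta>_0: "\<And>i. \<Theta> 0 i = \<theta> i"
    and corr_\<Theta>: "\<And>t i j. t \<ge> 0 \<Longrightarrow> i \<in> {1..n} \<Longrightarrow> j \<in> {1..n} \<Longrightarrow> corr t i j = cos (\<Theta> t i - \<Theta> t j)"
    and d\<Theta>: "\<And>t i. t \<ge> 0 \<Longrightarrow> i \<in> {1..n} \<Longrightarrow> ((\<lambda>s. \<Theta> s i) has_real_derivative
       (\<Sum>k=1..n. A t i k * sin (\<Theta> t k - \<Theta> t i))) (at t within {0..})"
    using phase_lift[OF e plane cont start] by blast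
  define \<rho> where "\<rho> t i = (\<Sum>k=1..n. A t i k * sin (\<Theta> t k - \<Theta> t i))" for t i
  define q where "q \<epsilon> s = (q0 + \<epsilon>) * exp (- 2 * (a - \<epsilon>) * s)" for \<epsilon> s
  have strict: "- (2 * arctan (q \<epsilon> t)) < (case (k, l) of (i, j) \<Rightarrow> \<lambda>t. \<Theta> t i - \<Theta> t j) t"
    if \<epsilon>: "\<epsilon> > 0" and kl: "k \<in> {1..n}" "l \<in> {1..n}" for \<epsilon> k l
  proof (rule first_contact[where I = "{1..n} \<times> {1..n}"
        and b' = "\<lambda>s. 2 * (a - \<epsilon>) * sin (2 * arctan (q \<epsilon> s))"
        and f = "\<lambda>(i, j) t. \<Theta> t i - \<Theta> t j" and f' = "\<lambda>(i, j) t. \<rho> t i - \<rho> t j"])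
    show "((\<lambda>s. - (2 * arctan (q \<epsilon> s))) has_real_derivative
        2 * (a - \<epsilon>) * sin (2 * arctan (q \<epsilon> s))) (at s within {0..})" for s
      using DERIV_minus[OF DERIV_double_arctan_exp[of "q0 + \<epsilon>" "a - \<epsilon>" s "{0..}"]]
      unfolding q_def mult_minus_left minus_minus .
  next
    fix ij assume ij: "ij \<in> {1..n} \<times> {1..n}"
    have "arctan q0 < arctan (q \<epsilon> 0)" using \<epsilon> by (simp add: q_def arctan_less_iff)
    then show "- (2 * arctan (q \<epsilon> 0)) < (case ij of (i, j) \<Rightarrow> \<lambda>t. \<Theta> t i - \<Theta> t j) 0"
      using arc[of "snd ij" "fst ij"] ij by (auto simp: \<Theta>_0)
  next
    fix ij s
    assume ij: "ij \<in> {1..n} \<times> {1..n}" and s: "s > 0"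
      and hit: "(case ij of (i, j) \<Rightarrow> \<lambda>t. \<Theta> t i - \<Theta> t j) s = - (2 * arctan (q \<epsilon> s))"
      and least: "\<forall>kl\<in>{1..n} \<times> {1..n}. - (2 * arctan (q \<epsilon> s)) \<le> (case kl of (i, j) \<Rightarrow> \<lambda>t. \<Theta> t i - \<Theta> t j) s"
    define D where "D = 2 * arctan (q \<epsilon> s)"
    obtain k l where kl: "ij = (k, l)" "k \<in> {1..n}" "l \<in> {1..n}" "\<Theta> s k - \<Theta> s l = - D"
      using ij hit by (auto simp: D_def)
    have all: "\<Theta> s l' - \<Theta> s k' \<le> D" if "k' \<in> {1..n}" "l' \<in> {1..n}" for k' l'
      using bspec[OF least, of "(k', l')"] that by (simp add: D_def)
    have "q \<epsilon> s > 0" using \<epsilon> q0 by (simp add: q_def)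
    then have D: "0 < D" "D < pi" using arctan_ubound[of "q \<epsilon> s"] by (auto simp: D_def)
    have "a * sin D \<le> \<rho> s k"
      unfolding \<rho>_def
    proof (rule extreme_phase_speed[where j = l])
      fix k' assume "k' \<in> {1..n}"
      then show "\<Theta> s k \<le> \<Theta> s k' \<and> \<Theta> s k' \<le> \<Theta> s k + D"
        using all[of k' l] all[of k k'] kl by auto
    qed (use kl s D in auto)
    moreover have "a * sin D \<le> (\<Sum>k'=1..n. A s l k' * sin (- \<Theta> s k' - - \<Theta> s l))"
    proof (rule extreme_phase_speed[where j = k and \<phi> = "\<lambda>k. - \<Theta> s k"])
      fix k' assume "k' \<in> {1..n}"
      then show "- \<Theta> s l \<le> - \<Theta> s k' \<and> - \<Theta> s k' \<le> - \<Theta> s l + D"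
        using all[of k k'] all[of k' l] kl by auto
    qed (use kl s D in auto)
    moreover have "(\<Sum>k'=1..n. A s l k' * sin (- \<Theta> s k' - - \<Theta> s l)) = - \<rho> s l"
    proof -
      have "sin (- \<Theta> s k' - - \<Theta> s l) = - sin (\<Theta> s k' - \<Theta> s l)" for k'
        using sin_minus[of "\<Theta> s k' - \<Theta> s l"] by (simp add: algebra_simps)
      then show ?thesis by (simp add: \<rho>_def sum_negf)
    qed
    moreover have "0 < sin D" using D by (intro sin_gt_zero) auto
    then have "2 * (a - \<epsilon>) * sin D < 2 * (a * sin D)" using \<epsilon> by simp
    ultimately have "2 * (a - \<epsilon>) * sin D < \<rho> s k - \<rho> s l" by linarith
    then show "2 * (a - \<epsilon>) * sin (2 * arctan (q \<epsilon> s)) < (case ij of (i, j) \<Rightarrow> \<lambda>t. \<rho> t i - \<rho> t j) s"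
      using kl by (simp add: D_def)
  next
    fix ij s assume "ij \<in> {1..n} \<times> {1..n}" "(s::real) \<ge> 0"
    then show "((case ij of (i, j) \<Rightarrow> \<lambda>t. \<Theta> t i - \<Theta> t j) has_real_derivative
        (case ij of (i, j) \<Rightarrow> \<lambda>t. \<rho> t i - \<rho> t j) s) (at s within {0..})"
      by (auto simp: \<rho>_def simp del: One_nat_def intro!: DERIV_diff d\<Theta>)
  qed (use t kl in auto)
  have "cos_half_tan (q 0 t) \<le> corr t i j"
  proof (rule le_at_zero_perturbation)
    show "isCont (\<lambda>\<epsilon>. cos_half_tan (q \<epsilon> t)) 0"
      unfolding cos_half_tan_def q_def using one_plus_square_pos(2)
      by (intro continuous_intros) auto
  next
    fix \<epsilon> :: real assume \<epsilon>: "\<epsilon> > 0"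
    have "cos (2 * arctan (q \<epsilon> t)) \<le> cos \<bar>\<Theta> t i - \<Theta> t j\<bar>"
      using strict[OF \<epsilon> i j] strict[OF \<epsilon> j i] arctan_ubound[of "q \<epsilon> t"]
      by (intro cos_monotone_0_pi_le) auto
    then show "cos_half_tan (q \<epsilon> t) \<le> corr t i j"
      by (simp add: cos_double_arctan corr_\<Theta>[OF t i j])
  qed
  then show ?thesis by (simp add: q_def)
qed

end

section \<open>Attention with rotary positions\<close>

lemma sum_UNIV_times_2: "(\<Sum>u\<in>UNIV. f u) = (\<Sum>l\<in>UNIV. f (l, 1) + f (l, 2))"
  for f :: "'r::finite \<times> 2 \<Rightarrow> real"
proof -
  have "(\<Sum>u\<in>UNIV. f u) = (\<Sum>l\<in>UNIV. \<Sum>m\<in>UNIV. f (l, m))"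
    by (simp add: sum.cartesian_product flip: UNIV_Times_UNIV)
  then show ?thesis by (simp add: sum_2)
qed

lemma rope_nth:
  "(rope \<omega> p *v z) $ (l, 1) = cos (\<omega> l * p) * z $ (l, 1) - sin (\<omega> l * p) * z $ (l, 2)"
  "(rope \<omega> p *v z) $ (l, 2) = sin (\<omega> l * p) * z $ (l, 1) + cos (\<omega> l * p) * z $ (l, 2)"
proof -
  have block: "(\<Sum>k\<in>UNIV. (if l = k then (f k :: real) else 0) * g k + (if l = k then h k else 0) * g' k)
      = f l * g l + h l * g' l" for f g h g'
  proof -
    have "(\<Sum>k\<in>UNIV. (if l = k then f k else 0) * g k + (if l = k then h k else 0) * g' k)
      = (\<Sum>k\<in>UNIV. if l = k then f k * g k + h k * g' k else 0)"
      by (intro sum.cong) auto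
    then show ?thesis by simp
  qed
  show "(rope \<omega> p *v z) $ (l, 1) = cos (\<omega> l * p) * z $ (l, 1) - sin (\<omega> l * p) * z $ (l, 2)"
    "(rope \<omega> p *v z) $ (l, 2) = sin (\<omega> l * p) * z $ (l, 1) + cos (\<omega> l * p) * z $ (l, 2)"
    by (simp_all add: matrix_vector_mult_def rope_def sum_UNIV_times_2 block) (simp_all add: rotation2_def)
qed

lemma norm_rope: "norm (rope \<omega> p *v z) = norm z"
proof -
  have "(c * X - s * Y)\<^sup>2 + (s * X + c * Y)\<^sup>2 = X\<^sup>2 + Y\<^sup>2" if "s\<^sup>2 + c\<^sup>2 = 1" for c s X Y :: real
  proof -
    have "(c * X - s * Y)\<^sup>2 + (s * X + c * Y)\<^sup>2 = (s\<^sup>2 + c\<^sup>2) * (X\<^sup>2 + Y\<^sup>2)"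
      by (simp add: power2_eq_square algebra_simps)
    with that show ?thesis by simp
  qed
  then have "(rope \<omega> p *v z) \<bullet> (rope \<omega> p *v z) = z \<bullet> z"
    by (simp add: inner_vec_def sum_UNIV_times_2 rope_nth flip: power2_eq_square)
  then show ?thesis by (simp add: norm_eq_sqrt_inner)
qed

lemma abs_score_le_1:
  assumes "norm (x i) = 1" "norm (x j) = 1"
  shows "\<bar>score \<omega> p x i j\<bar> \<le> 1"
  using Cauchy_Schwarz_ineq2[of "rope \<omega> (p i) *v x i" "rope \<omega> (p j) *v x j"] assms
  by (simp add: score_def norm_rope)

lemma kernel_bounds:
  assumes "\<beta> \<ge> 0" "norm (x i) = 1" "norm (x j) = 1"
  shows "exp (- \<beta>) \<le> kernel \<omega> \<beta> p x i j" "kernel \<omega> \<beta> p x i j \<le> exp \<beta>"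
proof -
  have "\<bar>\<beta> * score \<omega> p x i j\<bar> \<le> \<beta>"
    using abs_score_le_1[of x i j \<omega> p] assms mult_left_mono[of "\<bar>score \<omega> p x i j\<bar>" 1 \<beta>]
    by (simp add: abs_mult)
  then show "exp (- \<beta>) \<le> kernel \<omega> \<beta> p x i j" "kernel \<omega> \<beta> p x i j \<le> exp \<beta>"
    by (auto simp: kernel_def abs_le_iff)
qed

lemma kernel_sum_pos: "n \<ge> 1 \<Longrightarrow> 0 < (\<Sum>k=1..n. kernel \<omega> \<beta> p x i k)"
  by (intro sum_pos) (auto simp: kernel_def)

lemma attention_sum: "n \<ge> 1 \<Longrightarrow> (\<Sum>j=1..n. attention n \<omega> \<beta> p x i j) = 1"
  using kernel_sum_pos[of n \<omega> \<beta> p x i] by (simp add: attention_def flip: sum_divide_distrib)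

text \<open>Kernel values lie between \<open>exp (- \<beta>)\<close> and \<open>exp \<beta>\<close>, so any two of them differ by a factor of
  at most \<open>exp (2 * \<beta>)\<close>; estimate the \<open>n - 1\<close> other terms of the normaliser by the \<open>j\<close>-th one.\<close>

lemma attention_ge:
  assumes beta: "\<beta> \<ge> 0" and i: "i \<in> {1..n}" and j: "j \<in> {1..n}"
    and unit: "\<And>k. k \<in> {1..n} \<Longrightarrow> norm (x k) = 1"
  shows "1 / (1 + (real n - 1) * exp (2 * \<beta>)) \<le> attention n \<omega> \<beta> p x i j"
proof -
  let ?W = "kernel \<omega> \<beta> p x i"
  have n: "real n \<ge> 1" using i by simp
  have "?W k \<le> exp (2 * \<beta>) * ?W j" if k: "k \<in> {1..n}" for k
  proof -
    have "?W k \<le> exp \<beta>" by (rule kernel_bounds(2)[OF beta unit[OF i] unit[OF k]])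
    also have "\<dots> = exp (2 * \<beta>) * exp (- \<beta>)" by (simp flip: exp_add)
    also have "\<dots> \<le> exp (2 * \<beta>) * ?W j"
      by (intro mult_left_mono kernel_bounds(1)[OF beta unit[OF i] unit[OF j]]) simp
    finally show ?thesis .
  qed
  then have "(\<Sum>k\<in>{1..n} - {j}. ?W k) \<le> real (card ({1..n} - {j})) * (exp (2 * \<beta>) * ?W j)"
    by (intro sum_bounded_above) auto
  also have "real (card ({1..n} - {j})) = real n - 1" using j n by (simp add: of_nat_diff)
  finally have "(\<Sum>k=1..n. ?W k) \<le> ?W j * (1 + (real n - 1) * exp (2 * \<beta>))"
    using j by (subst sum.remove[of _ j]) (auto simp: algebra_simps)
  moreover have "0 < 1 + (real n - 1) * exp (2 * \<beta>)" using n by (intro add_pos_nonneg) auto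
  moreover have "0 < (\<Sum>k=1..n. ?W k)" using i by (intro kernel_sum_pos) auto
  ultimately show ?thesis unfolding attention_def by (simp add: divide_simps mult.commute)
qed

lemma continuous_on_attention:
  assumes "n \<ge> 1" "i \<in> {1..n}" "j \<in> {1..n}"
    and x: "\<And>k. k \<in> {1..n} \<Longrightarrow> continuous_on S (\<lambda>t. x t k)"
  shows "continuous_on S (\<lambda>t. attention n \<omega> \<beta> p (x t) i j)"
proof -
  have kernel: "continuous_on S (\<lambda>t. kernel \<omega> \<beta> p (x t) k l)" if "k \<in> {1..n}" "l \<in> {1..n}" for k l
    unfolding kernel_def score_def
    by (intro continuous_intros continuous_on_inner x that
        bounded_linear.continuous_on[OF matrix_vector_mul_bounded_linear])
  have "(\<Sum>k=1..n. kernel \<omega> \<beta> p (x t) i k) \<noteq> 0" for t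
    using kernel_sum_pos[OF assms(1), of \<omega> \<beta> p "x t" i] by simp
  then show ?thesis
    unfolding attention_def using assms(2,3)
    by (intro continuous_on_divide continuous_on_sum kernel) auto
qed

section \<open>The initial diameter\<close>

lemma sphere_dist_le_diameter:
  "i \<in> {1..n} \<Longrightarrow> j \<in> {1..n} \<Longrightarrow> sphere_dist (x i) (x j) \<le> geodesic_diameter n x"
  unfolding geodesic_diameter_def by (intro Max_ge) auto

lemma diameter_attained:
  assumes "n \<ge> 1"
  obtains i j where "i \<in> {1..n}" "j \<in> {1..n}" "geodesic_diameter n x = sphere_dist (x i) (x j)"
proof -
  have "geodesic_diameter n x \<in> (\<lambda>(i, j). sphere_dist (x i) (x j)) ` ({1..n} \<times> {1..n})"
    unfolding geodesic_diameter_def using assms by (intro Max_in) auto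
  with that show thesis by auto
qed

lemma plane_coordinates:
  fixes z :: "real ^ ('r::finite \<times> 2)"
  assumes "UNIV = {l :: 'r}"
  shows "z = (z \<bullet> axis (l, 1) 1) *\<^sub>R axis (l, 1) 1 + (z \<bullet> axis (l, 2) 1) *\<^sub>R axis (l, 2) 1"
proof (subst vec_eq_iff, rule allI)
  fix u :: "'r \<times> 2"
  have "fst u = l" using assms by auto
  moreover have "snd u = 1 \<or> snd u = 2" by (rule exhaust_2)
  ultimately have "u = (l, 1) \<or> u = (l, 2)" by (cases u) auto
  then show "z $ u = ((z \<bullet> axis (l, 1) 1) *\<^sub>R axis (l, 1) 1 + (z \<bullet> axis (l, 2) 1) *\<^sub>R axis (l, 2) 1) $ u"
    by (auto simp: inner_axis) (auto simp: axis_def)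
qed

theorem corollary6p5:
  fixes n :: nat
    and \<omega> :: "'r::finite \<Rightarrow> real"
    and \<beta> :: real
    and p :: "nat \<Rightarrow> real"
    and x :: "real \<Rightarrow> nat \<Rightarrow> real ^ ('r \<times> 2)"
    and a q0 :: real
    and Q :: "real \<Rightarrow> real"
  assumes n: "n \<ge> 2"
    and beta: "\<beta> \<ge> 0"
    and sol: "rope_flow_solution n \<omega> \<beta> p x"
    and a: "a = 1 / (1 + (real n - 1) * exp (2 * \<beta>))"
    and q0: "q0 = tan (geodesic_diameter n (x 0) / 2)"
    and Q: "\<And>t. Q t = q0 * exp (- 2 * a * t)"
    and init:
      "Min {x 0 i \<bullet> x 0 j | i j. 1 \<le> i \<and> i < j \<and> j \<le> n} \<ge> 0 \<or>
       (CARD('r \<times> 2) = 2 \<and>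
        (\<exists>\<theta> :: nat \<Rightarrow> real.
           (\<forall>i\<in>{1..n}. \<forall>l. x 0 i $ (l, 1) = cos (\<theta> i) \<and> x 0 i $ (l, 2) = sin (\<theta> i)) \<and>
           Max (\<theta> ` {1..n}) - Min (\<theta> ` {1..n}) < pi))"
  shows "\<exists>x_inf \<in> sphere 0 1.
           (\<forall>i\<in>{1..n}. ((\<lambda>t. x t i) \<longlongrightarrow> x_inf) at_top) \<and>
           (\<forall>i\<in>{1..n}. \<forall>t\<ge>0.
              sphere_dist (x t i) x_inf \<le> 1 / a * arsinh (Q t) \<and>
              1 / a * arsinh (Q t) \<le> q0 / a * exp (- 2 * a * t))"
proof -
  have n1: "n \<ge> 1" and one: "1 \<in> {1..n}" using n by auto
  have a_pos: "a > 0" unfolding a using n by (intro divide_pos_pos add_pos_nonneg) auto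
  have unit: "norm (x t i) = 1" if "t \<ge> 0" "i \<in> {1..n}" for t i
    using sol that by (auto simp: rope_flow_solution_def)
  interpret sphere_consensus n "\<lambda>t. attention n \<omega> \<beta> p (x t)" x a
  proof
    fix t :: real and i j assume "t \<ge> 0" "i \<in> {1..n}" "j \<in> {1..n}"
    then show "a \<le> attention n \<omega> \<beta> p (x t) i j"
      unfolding a by (intro attention_ge beta unit)
  next
    fix t :: real and i assume "t \<ge> 0" "i \<in> {1..n}"
    then show "((\<lambda>s. x s i) has_vector_derivative
        (\<Sum>j=1..n. attention n \<omega> \<beta> p (x t) i j *\<^sub>R (x t j - (x t i \<bullet> x t j) *\<^sub>R x t i))) (at t within {0..})"
      using sol by (auto simp: rope_flow_solution_def rope_field_def)
  qed (use n1 a_pos attention_sum[OF n1] unit in \<open>auto simp del: One_nat_def\<close>)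
  define D where "D = geodesic_diameter n (x 0)"
  have D_nonneg: "D \<ge> 0"
    using sphere_dist_le_diameter[OF one one, of "x 0"] corr_self[of 0 1] one
    by (simp add: D_def sphere_dist_def)
  have corr_ge_cos: "cos D \<le> corr 0 i j" if "i \<in> {1..n}" "j \<in> {1..n}" "D \<le> pi" for i j
  proof -
    have "\<bar>corr 0 i j\<bar> \<le> 1" using corr_abs_le that by simp
    then have "cos (sphere_dist (x 0 i) (x 0 j)) = corr 0 i j" "0 \<le> sphere_dist (x 0 i) (x 0 j)"
      by (auto simp: sphere_dist_def abs_le_iff intro!: cos_arccos arccos_lbound)
    moreover have "cos D \<le> cos (sphere_dist (x 0 i) (x 0 j))"
      using sphere_dist_le_diameter[of i n j "x 0"] that calculation(2)
      by (intro cos_monotone_0_pi_le) (auto simp: D_def)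
    ultimately show ?thesis by simp
  qed
  \<comment> \<open>Below \<open>pi\<close> the half diameter avoids the pole of the tangent, so \<open>q0\<close> determines \<open>D\<close>.\<close>
  have half: "q0 \<ge> 0 \<and> 2 * arctan q0 = D \<and> cos_half_tan q0 = cos D" if "D < pi"
  proof (intro conjI)
    show "2 * arctan q0 = D"
      using arctan_tan[of "D / 2"] that D_nonneg by (simp add: q0 D_def[symmetric])
    then show "cos_half_tan q0 = cos D" using cos_double_arctan[of q0] by simp
    have "0 \<le> arctan q0" using \<open>2 * arctan q0 = D\<close> D_nonneg by linarith
    then show "q0 \<ge> 0" by simp
  qed
  have contraction: "q0 \<ge> 0 \<and> (\<forall>t\<ge>0. \<forall>i\<in>{1..n}. \<forall>j\<in>{1..n}.
      cos_half_tan (q0 * exp (- 2 * a * t)) \<le> corr t i j)"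
    using init
  proof (elim disjE conjE exE)
    assume Min: "Min {x 0 i \<bullet> x 0 j | i j. 1 \<le> i \<and> i < j \<and> j \<le> n} \<ge> 0"
    have "{x 0 i \<bullet> x 0 j | i j. 1 \<le> i \<and> i < j \<and> j \<le> n} \<subseteq> (\<lambda>(i, j). corr 0 i j) ` ({1..n} \<times> {1..n})"
      by force
    then have fin: "finite {x 0 i \<bullet> x 0 j | i j. 1 \<le> i \<and> i < j \<and> j \<le> n}"
      by (rule finite_subset) auto
    have ordered: "0 \<le> corr 0 i j" if "1 \<le> i" "i < j" "j \<le> n" for i j
      using Min Min_le[OF fin, of "corr 0 i j"] that by fastforce
    have acute: "0 \<le> corr 0 i j" if "i \<in> {1..n}" "j \<in> {1..n}" for i j
      using ordered[of i j] ordered[of j i] corr_self[of 0 i] that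
      by (cases i j rule: linorder_cases) (auto simp: inner_commute)
    obtain i j where "i \<in> {1..n}" "j \<in> {1..n}" "D = arccos (corr 0 i j)"
      using diameter_attained[OF n1, of "x 0"] unfolding D_def sphere_dist_def by metis
    then have "D \<le> pi / 2"
      using arccos_le_pi2[of "corr 0 i j"] acute[of i j] corr_abs_le[of 0 i j] by auto
    then have "D < pi" using pi_gt_zero by linarith
    with half have q: "q0 \<ge> 0" "cos_half_tan q0 = cos D" by auto
    have "cos_half_tan (q0 * exp (- 2 * a * t)) \<le> corr t i j"
      if "t \<ge> 0" "i \<in> {1..n}" "j \<in> {1..n}" for t i j
      using that q \<open>D < pi\<close> by (intro acute_contraction acute) (auto intro!: corr_ge_cos)
    with q show ?thesis by blast
  next
    fix \<theta> :: "nat \<Rightarrow> real"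
    assume card: "CARD('r \<times> 2) = 2"
      and phases: "\<forall>i\<in>{1..n}. \<forall>l. x 0 i $ (l, 1) = cos (\<theta> i) \<and> x 0 i $ (l, 2) = sin (\<theta> i)"
      and arc: "Max (\<theta> ` {1..n}) - Min (\<theta> ` {1..n}) < pi"
    have "CARD('r) = 1" using card by simp
    then obtain l :: 'r where l: "UNIV = {l}" by (auto simp: card_1_singleton_iff)
    define e1 e2 :: "real ^ ('r \<times> 2)" where "e1 = axis (l, 1) 1" and "e2 = axis (l, 2) 1"
    have e: "norm e1 = 1" "norm e2 = 1" "e1 \<bullet> e2 = 0"
      by (auto simp: e1_def e2_def inner_axis_axis)
    have plane: "z = (z \<bullet> e1) *\<^sub>R e1 + (z \<bullet> e2) *\<^sub>R e2" for z :: "real ^ ('r \<times> 2)"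
      unfolding e1_def e2_def by (rule plane_coordinates[OF l])
    have start: "x 0 i = cos (\<theta> i) *\<^sub>R e1 + sin (\<theta> i) *\<^sub>R e2" if "i \<in> {1..n}" for i
      by (subst plane) (use phases that in \<open>simp add: e1_def e2_def inner_axis\<close>)
    have gap: "\<bar>\<theta> i - \<theta> j\<bar> < pi" if "i \<in> {1..n}" "j \<in> {1..n}" for i j
    proof -
      have "\<theta> k \<le> Max (\<theta> ` {1..n})" "Min (\<theta> ` {1..n}) \<le> \<theta> k" if "k \<in> {1..n}" for k
        using that by auto
      from this[OF that(1)] this[OF that(2)] arc show ?thesis by (simp add: abs_less_iff)
    qed
    \<comment> \<open>On an arc shorter than \<open>pi\<close> phase differences are geodesic distances, so the width of the arc is \<open>D\<close>.\<close>
    have dist: "sphere_dist (x 0 i) (x 0 j) = \<bar>\<theta> i - \<theta> j\<bar>" if "i \<in> {1..n}" "j \<in> {1..n}" for i j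
    proof -
      have "corr 0 i j = cos \<bar>\<theta> i - \<theta> j\<bar>"
        using e that by (simp add: start inner_add_left inner_add_right inner_commute[of e2 e1]
            dot_square_norm cos_diff)
      moreover have "arccos (cos \<bar>\<theta> i - \<theta> j\<bar>) = \<bar>\<theta> i - \<theta> j\<bar>"
        using gap[OF that] by (intro arccos_cos) auto
      ultimately show ?thesis by (simp only: sphere_dist_def)
    qed
    obtain i j where "i \<in> {1..n}" "j \<in> {1..n}" "D = sphere_dist (x 0 i) (x 0 j)"
      using diameter_attained[OF n1, of "x 0"] unfolding D_def by metis
    then have "D < pi" using dist gap by simp
    with half have q: "q0 \<ge> 0" "2 * arctan q0 = D" by auto
    have cont: "continuous_on {0..} (\<lambda>t. attention n \<omega> \<beta> p (x t) i j)"
      if "i \<in> {1..n}" "j \<in> {1..n}" for i j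
      by (rule continuous_on_attention[OF n1 that continuous_on_token])
    have "\<theta> i - \<theta> j \<le> 2 * arctan q0" if "i \<in> {1..n}" "j \<in> {1..n}" for i j
      using dist[OF that] sphere_dist_le_diameter[OF that, of "x 0"] q by (simp add: D_def)
    from arc_contraction[OF q(1) e plane cont start this] q show ?thesis by blast
  qed
  then obtain y where y: "y \<in> sphere 0 1" "\<forall>i\<in>{1..n}. ((\<lambda>t. x t i) \<longlongrightarrow> y) at_top"
    and rate: "\<forall>i\<in>{1..n}. \<forall>t\<ge>0. sphere_dist (x t i) y \<le> arsinh (q0 * exp (- 2 * a * t)) / a"
    using consensus_rate[of q0] by blast
  have "1 / a * arsinh (Q t) \<le> q0 / a * exp (- 2 * a * t)" for t
    using arsinh_le_self[of "Q t"] a_pos contraction by (simp add: Q divide_right_mono)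
  then show ?thesis using y rate by (intro bexI[of _ y]) (auto simp: Q)
qed

end
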